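(* Let $\mathcal X$ and $\mathcal Y$ be Ahlfors $n_1$-regular and $n_2$-regular spaces, respectively, with $n_1,n_2\in(0,\infty)$, and let $f:\mathcal X\to\mathcal Y$ be a quasisymmetric mapping onto $\mathcal Y$. Let $s_i\in(0,n_i)$, $i=1,2$, with $n_1/s_1=n_2/s_2$. Then $f$ induces an equivalence between $\dot M^{s_1}_{n_1/s_1,n_1/s_1}(\mathcal X)$ and $\dot M^{s_2}_{n_2/s_2,n_2/s_2}(\mathcal Y)$, and hence between $\dot{\mathcal B}^{s_1}_{n_1/s_1}(\mathcal X)$ and $\dot{\mathcal B}^{s_2}_{n_2/s_2}(\mathcal Y)$, in the following sense: there is $C>0$ such that every $u\in\dot M^{s_2}_{n_2/s_2,n_2/s_2}(\mathcal Y)$ has a representative $\widetilde u$ (equal to $u$ $\mu_{\mathcal Y}$-a.e.) with $\widetilde u\circ f\in\dot M^{s_1}_{n_1/s_1,n_1/s_1}(\mathcal X)$ and $\|\widetilde u\circ f\|_{\dot M^{s_1}_{n_1/s_1,n_1/s_1}(\mathcal X)}\le C\|u\|_{\dot M^{s_2}_{n_2/s_2,n_2/s_2}(\mathcal Y)}$, and symmetrically every $v\in\dot M^{s_1}_{n_1/s_1,n_1/s_1}(\mathcal X)$ has a representative $\widetilde v$ with $\|\widetilde v\circ f^{-1}\|_{\dot M^{s_2}_{n_2/s_2,n_2/s_2}(\mathcal Y)}\le C\|v\|_{\dot M^{s_1}_{n_1/s_1,n_1/s_1}(\mathcal X)}$; the same holds for the $\dot{\mathcal B}$ spaces.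
   Context: Metric measure space: $d$ metric, $\mu$ regular Borel, balls of finite positive measure. Ahlfors $n$-regular: $\mu(B(x,r))\sim r^n$ for all $x$ and $0<r<2\operatorname{diam}\mathcal X$. A homeomorphism $f:\mathcal X\to\mathcal Y$ is $\eta$-quasisymmetric (for a homeomorphism $\eta:[0,\infty)\to[0,\infty)$) if $d_{\mathcal Y}(f(x),f(a))/d_{\mathcal Y}(f(x),f(b))\le\eta(d_{\mathcal X}(x,a)/d_{\mathcal X}(x,b))$ for all $a,b,x$ with $x\ne b$. For measurable $u$ and $s>0$, $\mathbb D^s(u)$ is the set of sequences $\{g_k\}_{k\in\mathbb Z}$ of nonnegative measurable functions with a null set $E$ such that $|u(x)-u(y)|\le d(x,y)^s[g_k(x)+g_k(y)]$ for all $k$, $x,y\notin E$ with $2^{-k-1}\le d(x,y)<2^{-k}$; $\|u\|_{\dot M^s_{p,p}}=\inf_{\vec g\in\mathbb D^s(u)}(\int\sum_kg_k^p\,d\mu)^{1/p}$, $\dot M^s_{p,p}$ the measurable $u$ with this finite. $V(x,y)=\mu(B(x,d(x,y)))$; for $p\ge1$, $\dot{\mathcal B}^s_p$ is the set of $u\in L^p_{\rm loc}$ with $\int\int\frac{|u(x)-u(y)|^p}{d(x,y)^{sp}V(x,y)}d\mu(y)d\mu(x)<\infty$ (its $p$-th root being the norm). *)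

theory Defs
  imports "HOL-Analysis.Analysis"
begin

definition space_diam :: "'a::metric_space itself \<Rightarrow> ereal" where
  "space_diam _ = (SUP xy\<in>(UNIV::('a\<times>'a) set). ereal (dist (fst xy) (snd xy)))"

definition metric_measure_space :: "'a::metric_space measure \<Rightarrow> bool" where
  "metric_measure_space M \<longleftrightarrow>
     sets M = sets borel \<and>
     (\<forall>A\<in>sets M. emeasure M A = (INF U\<in>{U. open U \<and> A \<subseteq> U}. emeasure M U)) \<and>
     (\<forall>x r. r > 0 \<longrightarrow> 0 < emeasure M (ball x r) \<and> emeasure M (ball x r) < \<infinity>)"

definition ahlfors_regular :: "'a::metric_space measure \<Rightarrow> real \<Rightarrow> bool" where
  "ahlfors_regular M n \<longleftrightarrow>
     (\<exists>C\<ge>1. \<forall>(x::'a) r. 0 < r \<and> ereal r < 2 * space_diam TYPE('a) \<longrightarrow>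
        ennreal (r powr n / C) \<le> emeasure M (ball x r) \<and>
        emeasure M (ball x r) \<le> ennreal (C * r powr n))"

definition quasisymmetric :: "('a::metric_space \<Rightarrow> 'b::metric_space) \<Rightarrow> bool" where
  "quasisymmetric f \<longleftrightarrow>
     (\<exists>g. homeomorphism UNIV UNIV f g) \<and>
     (\<exists>\<eta> \<eta>'. homeomorphism {0::real..} {0..} \<eta> \<eta>' \<and>
        (\<forall>a b x. x \<noteq> b \<longrightarrow>
           dist (f x) (f a) / dist (f x) (f b) \<le> \<eta> (dist x a / dist x b)))"

definition frac_hajlasz_grad :: "'a::metric_space measure \<Rightarrow> real \<Rightarrow> ('a \<Rightarrow> real) \<Rightarrow> (int \<Rightarrow> 'a \<Rightarrow> real) set" where
  "frac_hajlasz_grad M s u = {g. (\<forall>k. g k \<in> borel_measurable M \<and> (\<forall>x. 0 \<le> g k x)) \<and>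
     (\<exists>E\<in>null_sets M. \<forall>k x y. x \<notin> E \<and> y \<notin> E \<and>
        2 powr (- real_of_int k - 1) \<le> dist x y \<and> dist x y < 2 powr (- real_of_int k) \<longrightarrow>
        \<bar>u x - u y\<bar> \<le> dist x y powr s * (g k x + g k y))}"

definition hajlasz_besov_pow :: "'a::metric_space measure \<Rightarrow> real \<Rightarrow> real \<Rightarrow> ('a \<Rightarrow> real) \<Rightarrow> ennreal" where
  "hajlasz_besov_pow M s p u =
     (INF g\<in>frac_hajlasz_grad M s u.
        \<integral>\<^sup>+ x. (\<integral>\<^sup>+ k. ennreal (g k x powr p) \<partial>count_space (UNIV::int set)) \<partial>M)"

definition in_hajlasz_besov :: "'a::metric_space measure \<Rightarrow> real \<Rightarrow> real \<Rightarrow> ('a \<Rightarrow> real) \<Rightarrow> bool" where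
  "in_hajlasz_besov M s p u \<longleftrightarrow> u \<in> borel_measurable M \<and> hajlasz_besov_pow M s p u < \<infinity>"

definition hajlasz_besov_norm :: "'a::metric_space measure \<Rightarrow> real \<Rightarrow> real \<Rightarrow> ('a \<Rightarrow> real) \<Rightarrow> real" where
  "hajlasz_besov_norm M s p u = enn2real (hajlasz_besov_pow M s p u) powr (1 / p)"

definition Vball :: "'a::metric_space measure \<Rightarrow> 'a \<Rightarrow> 'a \<Rightarrow> real" where
  "Vball M x y = measure M (ball x (dist x y))"

definition Lp_loc :: "'a::metric_space measure \<Rightarrow> real \<Rightarrow> ('a \<Rightarrow> real) \<Rightarrow> bool" where
  "Lp_loc M p u \<longleftrightarrow> u \<in> borel_measurable M \<and>
     (\<forall>x r. (\<integral>\<^sup>+ y. indicator (ball x r) y * ennreal (\<bar>u y\<bar> powr p) \<partial>M) < \<infinity>)"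

definition besov_pow :: "'a::metric_space measure \<Rightarrow> real \<Rightarrow> real \<Rightarrow> ('a \<Rightarrow> real) \<Rightarrow> ennreal" where
  "besov_pow M s p u =
     (\<integral>\<^sup>+ x. (\<integral>\<^sup>+ y. ennreal (\<bar>u x - u y\<bar> powr p / (dist x y powr (s * p) * Vball M x y)) \<partial>M) \<partial>M)"

definition in_besov :: "'a::metric_space measure \<Rightarrow> real \<Rightarrow> real \<Rightarrow> ('a \<Rightarrow> real) \<Rightarrow> bool" where
  "in_besov M s p u \<longleftrightarrow> Lp_loc M p u \<and> besov_pow M s p u < \<infinity>"

definition besov_norm :: "'a::metric_space measure \<Rightarrow> real \<Rightarrow> real \<Rightarrow> ('a \<Rightarrow> real) \<Rightarrow> real" where
  "besov_norm M s p u = enn2real (besov_pow M s p u) powr (1 / p)"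

end

(* Pull the measure of the target back along f to a second measure S on the source. Quasisymmetry and
  Ahlfors regularity make S doubling with geometric decay at small scales, and identify the Besov
  energy on the target (at the conformal exponent sp = n) with the double integral of
  |v x - v y|^p / S(ball x (dist x y))^2, where v = u o f. Since f need not preserve null sets, v itself
  is useless for M; it is replaced by the limit of its S-averages over dyadic balls. Telescoping bounds
  the increments of this limit at every point by sums of mean oscillations, and these sums are a
  fractional Hajlasz gradient whose M-norm is controlled, via Tonelli, by the energy.
  On a single Ahlfors regular space the Hajlasz norm dominates the Besov norm, so both kinds of spaces
  follow; the inverse map is treated in the same way. *)

theory Submission
  imports Defs
begin

section \<open>Measurability on separable metric spaces\<close>

text \<open>The relation s p = n makes the problem conformally invariant. On the target,
  \<open>Vball\<close> and the power of the distance in the Besov kernel are both at most constants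
  times the S-mass of the corresponding ball in the source, so the kernel dominates one that
  mentions S alone and the target metric drops out. On the source, an oscillation at scale k enters
  with weight \<open>rad k powr (- n)\<close>, which the M-mass of a ball of that radius cancels.
  The averages see only S, whereas the gradient must be controlled up to M-null sets. No
  differentiation theorem relates the two measures, so increments are followed along chains of balls
  at individual points, and the only exceptional set is one where an M-integrable sum is infinite.
  Agreement with v is a separate statement, about S. Bounded spaces shape the hypotheses: lower
  regularity and the decay of S stop at the scale of the diameter. Radii are therefore compared with
  the distance of some pair of points, and scales are restricted by \<open>good\<close>.\<close>

text \<open>Tonelli needs measurability for the product of the Borel sigma-algebras, which can be
  smaller than the Borel sigma-algebra of the product. A countable infimum over a dense set reduces
  the distance to functions of one coordinate.\<close>

lemma borel_measurable_dist_separable: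
  fixes D :: "'a::metric_space set"
  assumes "countable D" "closure D = UNIV"
  shows "(\<lambda>z. dist (fst z) (snd z) :: real) \<in> borel_measurable (borel \<Otimes>\<^sub>M (borel :: 'a measure))"
proof -
  have D: "D \<noteq> {}" using assms(2) by auto
  have eq: "dist x y = (INF q\<in>D. dist x q + dist q y)" for x y :: 'a
  proof (rule antisym)
    show "dist x y \<le> (INF q\<in>D. dist x q + dist q y)"
      by (rule cINF_greatest[OF D]) (rule dist_triangle)
    show "(INF q\<in>D. dist x q + dist q y) \<le> dist x y"
    proof (rule field_le_epsilon)
      fix e :: real assume "0 < e"
      moreover have "x \<in> closure D" using assms(2) by simp
      ultimately obtain q where q: "q \<in> D" "dist q x < e / 2"
        unfolding closure_approachable by (meson half_gt_zero)
      have "(INF q\<in>D. dist x q + dist q y) \<le> dist x q + dist q y"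
        by (rule cINF_lower[OF _ q(1)]) (auto intro!: bdd_belowI2[where m=0])
      also have "\<dots> \<le> dist x y + e"
        using dist_triangle[of q y x] q(2) by (simp add: dist_commute)
      finally show "(INF q\<in>D. dist x q + dist q y) \<le> dist x y + e" .
    qed
  qed
  have "(\<lambda>z. INF q\<in>D. dist (fst z) q + dist q (snd z))
      \<in> borel_measurable (borel \<Otimes>\<^sub>M (borel :: 'a measure))"
    by (rule borel_measurable_cINF[OF assms(1)])
       (auto intro!: bdd_belowI2[where m=0] borel_measurable_add
         measurable_compose[OF measurable_fst] measurable_compose[OF measurable_snd]
         borel_measurable_continuous_onI continuous_intros)
  then show ?thesis by (simp only: eq[symmetric])
qed

lemma sigma_finite_of_balls:
  fixes N :: "'a::metric_space measure"
  assumes "sets N = sets borel" "\<And>x r. emeasure N (ball x r) < \<infinity>"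
  shows "sigma_finite_measure N"
proof
  fix x0 :: 'a
  have sp: "space N = UNIV" using sets_eq_imp_space_eq[OF assms(1)] by simp
  let ?A = "range (\<lambda>m. ball x0 (real m))"
  have "\<Union>?A = UNIV" using reals_Archimedean2 by (fastforce simp: set_eq_iff)
  then show "\<exists>A. countable A \<and> A \<subseteq> sets N \<and> \<Union>A = space N \<and> (\<forall>a\<in>A. emeasure N a \<noteq> \<infinity>)"
    using assms sp by (intro exI[of _ ?A]) (auto simp: less_top[symmetric])
qed

lemma nn_integral_int_swap:
  fixes g :: "int \<Rightarrow> 'a \<Rightarrow> ennreal"
  assumes [measurable]: "\<And>k. g k \<in> borel_measurable M"
  shows "(\<integral>\<^sup>+ x. (\<integral>\<^sup>+ k. g k x \<partial>count_space UNIV) \<partial>M) =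
    (\<integral>\<^sup>+ k. (\<integral>\<^sup>+ x. g k x \<partial>M) \<partial>count_space UNIV)"
proof -
  have *: "(\<integral>\<^sup>+ k. h k \<partial>count_space UNIV) = (\<Sum>i. h (int_decode i))" for h :: "int \<Rightarrow> ennreal"
    using nn_integral_bij_count_space[OF bij_int_decode, of h]
    by (simp add: nn_integral_count_space_nat)
  show ?thesis unfolding * by (rule nn_integral_suminf) simp
qed

text \<open>Orders a sum over scales from the finest contributing scale towards coarser ones, the
  order in which it is dominated by a geometric series.\<close>

lemma nn_integral_int_reflect:
  fixes f :: "int \<Rightarrow> ennreal"
  assumes "\<And>k. K < k \<Longrightarrow> f k = 0"
  shows "(\<integral>\<^sup>+ k. f k \<partial>count_space UNIV) = (\<Sum>i. f (K - int i))"
proof -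
  have b: "bij_betw (\<lambda>i. K - int i) UNIV {..K}"
    by (rule bij_betwI[where g="\<lambda>k. nat (K - k)"]) auto
  have "(\<integral>\<^sup>+ k. f k \<partial>count_space UNIV) = (\<integral>\<^sup>+ k. f k * indicator {..K} k \<partial>count_space UNIV)"
    using assms by (intro nn_integral_cong) (auto simp: indicator_def not_le)
  also have "\<dots> = (\<integral>\<^sup>+ k. f k \<partial>count_space {..K})"
    by (simp add: nn_integral_count_space_indicator)
  also have "\<dots> = (\<Sum>i. f (K - int i))"
    using nn_integral_bij_count_space[OF b, of f] by (simp add: nn_integral_count_space_nat)
  finally show ?thesis .
qed

lemma nn_integral_int_shift:
  fixes f :: "int \<Rightarrow> ennreal"
  shows "(\<integral>\<^sup>+ k. f (k + c) \<partial>count_space UNIV) = (\<integral>\<^sup>+ k. f k \<partial>count_space UNIV)"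
proof -
  have "bij_betw (\<lambda>k. k + c) UNIV UNIV" by (rule bij_betwI[where g="\<lambda>k. k - c"]) auto
  then show ?thesis by (rule nn_integral_bij_count_space)
qed

lemma dyadic_scale_exists:
  assumes "0 < (d::real)"
  obtains k :: int where "2 powr (- real_of_int k - 1) \<le> d" "d < 2 powr (- real_of_int k)"
proof
  let ?k = "- \<lfloor>log 2 d\<rfloor> - 1"
  have d: "d = 2 powr (log 2 d)" using assms by simp
  have "2 powr (- real_of_int ?k - 1) \<le> 2 powr (log 2 d)" by simp
  then show "2 powr (- real_of_int ?k - 1) \<le> d" using d by simp
  have "2 powr (log 2 d) < 2 powr (- real_of_int ?k)" by simp linarith
  then show "d < 2 powr (- real_of_int ?k)" using d by simp
qed

lemma powr_add_le:
  fixes a b p :: real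
  assumes "0 \<le> a" "0 \<le> b" "0 \<le> p"
  shows "(a + b) powr p \<le> 2 powr p * (a powr p + b powr p)"
proof -
  have "(a + b) powr p \<le> (2 * max a b) powr p" using assms by (intro powr_mono2) auto
  also have "\<dots> = 2 powr p * max a b powr p" using assms by (simp add: powr_mult)
  also have "\<dots> \<le> 2 powr p * (a powr p + b powr p)"
    by (intro mult_left_mono) (auto simp: max_def)
  finally show ?thesis .
qed

section \<open>Ahlfors regular spaces\<close>

lemma ball_UNIV_of_diam:
  fixes x :: "'a::metric_space"
  assumes "space_diam TYPE('a) = ereal \<delta>" "\<delta> < r"
  shows "ball x r = UNIV"
proof -
  have "dist x y < r" for y
  proof -
    have "ereal (dist x y) \<le> space_diam TYPE('a)"
      unfolding space_diam_def by (rule SUP_upper2[of "(x,y)"]) auto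
    then show ?thesis using assms by simp
  qed
  then show ?thesis by auto
qed

lemma less_two_diam:
  fixes a b :: "'a::metric_space"
  assumes "0 < r" "r \<le> dist a b"
  shows "ereal r < 2 * space_diam TYPE('a)"
proof -
  have le: "ereal (dist a b) \<le> space_diam TYPE('a)"
    unfolding space_diam_def by (rule SUP_upper2[of "(a,b)"]) auto
  have "ereal r < ereal (2 * dist a b)" using assms by simp
  also have "\<dots> = 2 * ereal (dist a b)" by simp
  also have "\<dots> \<le> 2 * space_diam TYPE('a)" by (rule ereal_mult_left_mono[OF le]) simp
  finally show ?thesis .
qed

text \<open>Frees regularity from the extended-real diameter. The upper bound survives for all radii
  because large balls are the whole space; the lower bound is kept for radii not exceeding some
  actual distance.\<close>

lemma ahlfors_bounds:
  fixes M :: "'a::metric_space measure"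
  assumes "ahlfors_regular M n" "0 < n" "a0 \<noteq> (b0::'a)"
  obtains C where "1 \<le> C"
    "\<And>x r. 0 < r \<Longrightarrow> emeasure M (ball x r) \<le> ennreal (C * r powr n)"
    "\<And>x r a b. 0 < r \<Longrightarrow> r \<le> dist a (b::'a) \<Longrightarrow> ennreal (r powr n / C) \<le> emeasure M (ball x r)"
proof -
  obtain C where C: "1 \<le> C" and reg: "\<And>x r. 0 < r \<Longrightarrow> ereal r < 2 * space_diam TYPE('a) \<Longrightarrow>
        ennreal (r powr n / C) \<le> emeasure M (ball x r) \<and>
        emeasure M (ball x r) \<le> ennreal (C * r powr n)"
    using assms(1) unfolding ahlfors_regular_def by blast
  have dpos: "0 < space_diam TYPE('a)"
  proof -
    have "ereal (dist a0 b0) \<le> space_diam TYPE('a)"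
      unfolding space_diam_def by (rule SUP_upper2[of "(a0,b0)"]) auto
    moreover have "0 < ereal (dist a0 b0)" using assms(3) by simp
    ultimately show ?thesis by (rule less_le_trans[rotated])
  qed
  have up: "emeasure M (ball x r) \<le> ennreal (C * r powr n)" if "0 < r" for x :: 'a and r
  proof (cases "ereal r < 2 * space_diam TYPE('a)")
    case True then show ?thesis using reg that by blast
  next
    case False
    then have "2 * space_diam TYPE('a) \<le> ereal r" by simp
    then obtain \<delta> where \<delta>: "space_diam TYPE('a) = ereal \<delta>" using dpos
      by (cases "space_diam TYPE('a)") auto
    then have "0 < \<delta>" "2 * \<delta> \<le> r" using dpos \<open>2 * _ \<le> _\<close> by auto
    \<comment> \<open>A radius strictly between the diameter and its double: the ball is already the
      whole space, yet regularity still applies to it.\<close>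
    then have b: "ball x r = ball x (3 / 2 * \<delta>)"
      using ball_UNIV_of_diam[OF \<delta>, of r x] ball_UNIV_of_diam[OF \<delta>, of "3 / 2 * \<delta>" x] by simp
    have "emeasure M (ball x r) \<le> ennreal (C * (3 / 2 * \<delta>) powr n)"
      unfolding b using \<delta> \<open>0 < \<delta>\<close> by (intro conjunct2[OF reg]) auto
    also have "\<dots> \<le> ennreal (C * r powr n)" using C \<open>0 < \<delta>\<close> \<open>2 * \<delta> \<le> r\<close> assms(2)
      by (intro ennreal_leI mult_left_mono powr_mono2) auto
    finally show ?thesis .
  qed
  show ?thesis
    by (rule that[OF C]) (use up reg less_two_diam in blast)+
qed

text \<open>An empty annulus would give two concentric balls the same mass although the ratio of
  their radii is \<Lambda>. Regularity allows at most \<open>\<Lambda> powr n = C\<^sup>2\<close>,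
  and \<Lambda> is chosen to exceed this by a factor 2.\<close>

lemma ahlfors_uniformly_perfect:
  fixes M :: "'a::metric_space measure"
  assumes "sets M = sets borel" "ahlfors_regular M n" "0 < n" "a0 \<noteq> (b0::'a)"
  obtains \<Lambda> where "1 \<le> \<Lambda>"
    "\<And>(x::'a) r a b. 0 < r \<Longrightarrow> r \<le> dist a (b::'a) \<Longrightarrow> \<exists>y. r / \<Lambda> \<le> dist x y \<and> dist x y < r"
proof -
  obtain C where C: "1 \<le> C" and up: "\<And>x r. 0 < r \<Longrightarrow> emeasure M (ball x r) \<le> ennreal (C * r powr n)"
    and lo: "\<And>x r a b. 0 < r \<Longrightarrow> r \<le> dist a (b::'a) \<Longrightarrow> ennreal (r powr n / C) \<le> emeasure M (ball x r)"
    using ahlfors_bounds[OF assms(2-4)] by metis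
  define \<Lambda> where "\<Lambda> = (2 * C\<^sup>2) powr (1 / n)"
  have C2: "1 \<le> 2 * C\<^sup>2" using C by (simp add: one_le_power order.trans[of 1 2])
  have L1: "1 \<le> \<Lambda>" unfolding \<Lambda>_def using C2 assms(3) by (intro ge_one_powr_ge_zero) auto
  have Ln: "\<Lambda> powr n = 2 * C\<^sup>2" unfolding \<Lambda>_def using C2 assms(3) by (simp add: powr_powr)
  show ?thesis
  proof (rule that[OF L1])
    fix x :: 'a and r a b assume r: "0 < r" "r \<le> dist a (b::'a)"
    show "\<exists>y. r / \<Lambda> \<le> dist x y \<and> dist x y < r"
    proof (rule ccontr)
      assume "\<not> ?thesis"
      then have "ball x r \<subseteq> ball x (r / \<Lambda>)" by force
      then have "emeasure M (ball x r) \<le> emeasure M (ball x (r / \<Lambda>))"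
        by (intro emeasure_mono) (auto simp: assms)
      moreover have "ennreal (r powr n / C) \<le> emeasure M (ball x r)" by (rule lo[OF r])
      moreover have "emeasure M (ball x (r / \<Lambda>)) \<le> ennreal (C * (r / \<Lambda>) powr n)"
        by (rule up) (use r L1 in simp)
      ultimately have "ennreal (r powr n / C) \<le> ennreal (C * (r / \<Lambda>) powr n)" by order
      then have "r powr n / C \<le> C * (r / \<Lambda>) powr n" using C by (subst (asm) ennreal_le_iff) auto
      also have "(r / \<Lambda>) powr n = r powr n / (2 * C\<^sup>2)" using r L1 Ln by (simp add: powr_divide)
      finally have "r powr n / C \<le> r powr n / (2 * C)" using C by (simp add: power2_eq_square)
      moreover have "r powr n > 0" using r by simp
      ultimately show False using C by (simp add: field_simps)
    qed
  qed
qed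

text \<open>Packing: the balls of radius \<open>e / 2\<close> about e-separated points are disjoint,
  each has mass at least \<open>c\<close>, and all lie in a ball of mass at most \<open>K\<close>.
  Cardinalities are thus bounded, and a separated set of maximal cardinality is a net.\<close>

lemma ahlfors_finite_net:
  fixes M :: "'a::metric_space measure"
  assumes "sets M = sets borel" "ahlfors_regular M n" "0 < n" "0 < e" "e \<le> dist a (b::'a)"
  shows "\<exists>T. finite T \<and> (\<forall>x\<in>ball (x0::'a) r. \<exists>t\<in>T. dist t x < e)"
proof -
  have ab: "a \<noteq> b" using assms(4,5) by auto
  obtain C where C: "1 \<le> C" and up: "\<And>x r. 0 < r \<Longrightarrow> emeasure M (ball x r) \<le> ennreal (C * r powr n)"
    and lo: "\<And>x r a b. 0 < r \<Longrightarrow> r \<le> dist a (b::'a) \<Longrightarrow> ennreal (r powr n / C) \<le> emeasure M (ball x r)"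
    using ahlfors_bounds[OF assms(2,3) ab] by metis
  define c where "c = (e / 2) powr n / C"
  have c: "0 < c" unfolding c_def using C assms(4) by simp
  define K where "K = C * (\<bar>r\<bar> + e) powr n"
  define P where "P T \<longleftrightarrow> finite T \<and> T \<subseteq> ball x0 r \<and> (\<forall>s\<in>T. \<forall>t\<in>T. s \<noteq> t \<longrightarrow> e \<le> dist s t)" for T
  have bound: "card T < Suc (nat \<lceil>K / c\<rceil>)" if "P T" for T
  proof -
    have T: "finite T" "T \<subseteq> ball x0 r" "\<And>s t. s \<in> T \<Longrightarrow> t \<in> T \<Longrightarrow> s \<noteq> t \<Longrightarrow> e \<le> dist s t"
      using that unfolding P_def by blast+
    have disj: "disjoint_family_on (\<lambda>t. ball t (e / 2)) T"
      unfolding disjoint_family_on_def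
    proof (intro ballI impI)
      fix s t assume "s \<in> T" "t \<in> T" "s \<noteq> t"
      then have "e \<le> dist s t" by (rule T(3))
      then show "ball s (e / 2) \<inter> ball t (e / 2) = {}"
         by (intro disjoint_ballI) simp
    qed
    have "ennreal (real (card T) * c) = (\<Sum>t\<in>T. ennreal c)"
      using c by (simp add: ennreal_mult ennreal_of_nat_eq_real_of_nat)
    also have "\<dots> \<le> (\<Sum>t\<in>T. emeasure M (ball t (e / 2)))"
      unfolding c_def using assms(4,5) by (intro sum_mono lo[of _ a b]) auto
    also have "\<dots> = emeasure M (\<Union>t\<in>T. ball t (e / 2))"
      using T(1) disj by (intro sum_emeasure) (auto simp: assms(1))
    also have "\<dots> \<le> emeasure M (ball x0 (\<bar>r\<bar> + e))"
    proof (intro emeasure_mono UN_least subsetI)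
      fix t y assume "t \<in> T" "y \<in> ball t (e / 2)"
      then have "dist x0 t < r" "dist t y < e / 2" using T(2) by auto
      then show "y \<in> ball x0 (\<bar>r\<bar> + e)" using dist_triangle[of x0 y t] assms(4) by simp
    qed (simp add: assms(1))
    also have "\<dots> \<le> ennreal K" unfolding K_def by (rule up) (use assms(4) in simp)
    finally have "real (card T) * c \<le> K"
      using C by (subst (asm) ennreal_le_iff) (auto simp: K_def)
    then have "real (card T) \<le> K / c" using c by (simp add: field_simps)
    then show ?thesis by linarith
  qed
  have "P {}" unfolding P_def by simp
  then obtain T where T: "P T" "\<And>T'. P T' \<Longrightarrow> card T' \<le> card T"
    using ex_has_greatest_nat[of P "{}" card] bound by blast
  have "\<exists>t\<in>T. dist t x < e" if x: "x \<in> ball x0 r" for x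
  proof (rule ccontr)
    assume far: "\<not> ?thesis"
    then have "x \<notin> T" using assms(4) by force
    moreover have "P (insert x T)"
      using T(1) x far unfolding P_def by (auto simp: dist_commute not_less)
    ultimately show False using T(2)[of "insert x T"] T(1) unfolding P_def by auto
  qed
  moreover have "finite T" using T(1) unfolding P_def by blast
  ultimately show ?thesis by (intro exI[of _ T]) simp
qed

lemma ahlfors_separable:
  fixes M :: "'a::metric_space measure"
  assumes "sets M = sets borel" "ahlfors_regular M n" "0 < n" "a0 \<noteq> (b0::'a)"
  shows "\<exists>D::'a set. countable D \<and> closure D = UNIV"
proof -
  \<comment> \<open>The meshes tend to zero while staying below a realised distance, where the lower
    regularity bound is available.\<close>
  define e where "e m = dist a0 b0 / (real m + 1)" for m :: nat
  have e: "0 < e m" "e m \<le> dist a0 b0" for m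
    using assms(4) unfolding e_def by (auto simp: field_simps)
  have "\<exists>T. finite T \<and> (\<forall>x\<in>ball a0 (real m). \<exists>t\<in>T. dist t x < e m)" for m
    by (rule ahlfors_finite_net[OF assms(1-3) e])
  then obtain T where T: "\<And>m. finite (T m)" "\<And>m x. x \<in> ball a0 (real m) \<Longrightarrow> \<exists>t\<in>T m. dist t x < e m"
    by metis
  have "\<exists>t\<in>\<Union>(range T). dist t x < \<epsilon>" if "0 < \<epsilon>" for x \<epsilon>
  proof -
    obtain m where m: "real m > dist a0 x + dist a0 b0 / \<epsilon>" using reals_Archimedean2 by blast
    have "0 \<le> dist a0 b0 / \<epsilon>" using that by simp
    then have "x \<in> ball a0 (real m)" using m by simp
    then obtain t where "t \<in> T m" "dist t x < e m" using T(2) by blast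
    moreover have "e m \<le> \<epsilon>"
    proof -
      have "dist a0 b0 / \<epsilon> \<le> real m + 1" using m zero_le_dist[of a0 x] by linarith
      then show ?thesis unfolding e_def using that by (simp add: field_simps)
    qed
    ultimately show ?thesis by force
  qed
  then have "closure (\<Union>(range T)) = UNIV" by (auto simp: closure_approachable)
  then show ?thesis using T(1) by (intro exI[of _ "\<Union>(range T)"]) (auto intro: countable_finite)
qed

section \<open>Averages over balls\<close>

text \<open>Integrability of \<open>v\<close> on \<open>A\<close> is not assumed: the p-th power
  bound supplies it, so that the Bochner integral does not take its default value.\<close>

lemma average_close:
  fixes v :: "'a \<Rightarrow> real"
  assumes [measurable]: "A \<in> sets S" "v \<in> borel_measurable S"
    and fin: "emeasure S A < \<infinity>" and pos: "0 < measure S A" and "0 < l" "1 \<le> p"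
    and le: "(\<integral>\<^sup>+ y. indicator A y * ennreal (\<bar>v y - c\<bar> powr p) \<partial>S) \<le> ennreal (measure S A * l powr p)"
  shows "\<bar>(\<integral> y. indicator A y * v y \<partial>S) / measure S A - c\<bar> \<le> 2 * l"
proof -
  let ?m = "measure S A" and ?h = "\<lambda>y. indicator A y * (v y - c) :: real"
  have eA: "emeasure S A = ennreal ?m" using fin by (simp add: emeasure_eq_ennreal_measure less_top)
  \<comment> \<open>Young's inequality replaces Jensen's, at the price of a factor 2.\<close>
  have young: "t \<le> l + l powr (1 - p) * t powr p" if "0 \<le> t" for t
  proof (cases "t \<le> l")
    case True then show ?thesis by (simp add: add_increasing2)
  next
    case False
    then have t: "l \<le> t" "0 < t" using \<open>0 < l\<close> by auto
    have "t = t powr (1 - p) * t powr p" using t by (simp add: powr_add[symmetric])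
    also have "\<dots> \<le> l powr (1 - p) * t powr p"
      using t \<open>0 < l\<close> \<open>1 \<le> p\<close> by (intro mult_right_mono powr_mono2') auto
    finally show ?thesis using \<open>0 < l\<close> by simp
  qed
  have "(\<integral>\<^sup>+ y. ennreal \<bar>?h y\<bar> \<partial>S) \<le>
      (\<integral>\<^sup>+ y. ennreal l * indicator A y +
        ennreal (l powr (1 - p)) * (indicator A y * ennreal (\<bar>v y - c\<bar> powr p)) \<partial>S)"
    using \<open>0 < l\<close> young
    by (intro nn_integral_mono)
       (auto simp: indicator_def ennreal_mult[symmetric] ennreal_plus[symmetric] simp del: ennreal_plus
         intro!: ennreal_leI)
  also have "\<dots> = ennreal l * emeasure S A +
      ennreal (l powr (1 - p)) * (\<integral>\<^sup>+ y. indicator A y * ennreal (\<bar>v y - c\<bar> powr p) \<partial>S)"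
    by (simp add: nn_integral_add nn_integral_cmult nn_integral_cmult_indicator)
  also have "\<dots> \<le> ennreal l * ennreal ?m + ennreal (l powr (1 - p)) * ennreal (?m * l powr p)"
    unfolding eA using le by (intro add_mono mult_left_mono) auto
  also have "\<dots> = ennreal (2 * l * ?m)"
  proof -
    have "l powr (1 - p) * l powr p = l" using \<open>0 < l\<close> by (simp add: powr_add[symmetric])
    then have "l powr (1 - p) * (?m * l powr p) = l * ?m" by (metis mult.assoc mult.commute)
    then show ?thesis using \<open>0 < l\<close>
      by (simp add: ennreal_mult[symmetric] ennreal_plus[symmetric] del: ennreal_plus)
  qed
  finally have b: "(\<integral>\<^sup>+ y. ennreal \<bar>?h y\<bar> \<partial>S) \<le> ennreal (2 * l * ?m)" .
  have int_h: "integrable S ?h"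
    using b by (intro integrableI_bounded) (auto intro: le_less_trans)
  have "\<bar>\<integral> y. ?h y \<partial>S\<bar> \<le> 2 * l * ?m"
  proof -
    have "ennreal \<bar>\<integral> y. ?h y \<partial>S\<bar> \<le> (\<integral>\<^sup>+ y. ennreal \<bar>?h y\<bar> \<partial>S)"
      using integral_norm_bound_ennreal[OF int_h] by simp
    then have "ennreal \<bar>\<integral> y. ?h y \<partial>S\<bar> \<le> ennreal (2 * l * ?m)" using b by order
    then show ?thesis using \<open>0 < l\<close> by (subst (asm) ennreal_le_iff) auto
  qed
  moreover have "(\<integral> y. indicator A y * v y \<partial>S) = (\<integral> y. ?h y \<partial>S) + c * ?m"
  proof -
    have i: "integrable S (\<lambda>y. c * indicator A y :: real)"
      using fin by (intro integrable_mult_right integrable_real_indicator) auto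
    have "(\<integral> y. indicator A y * v y \<partial>S) = (\<integral> y. ?h y + c * indicator A y \<partial>S)"
      by (intro Bochner_Integration.integral_cong) (auto simp: algebra_simps)
    also have "\<dots> = (\<integral> y. ?h y \<partial>S) + (\<integral> y. c * indicator A y \<partial>S)"
      by (rule Bochner_Integration.integral_add[OF int_h i])
    finally show ?thesis by simp
  qed
  ultimately show ?thesis using pos by (simp add: field_simps abs_le_iff)
qed

text \<open>The first two terms are both estimated because two points will be compared through
  averages at adjacent scales.\<close>

lemma geometric_increments_convergent:
  fixes s :: "nat \<Rightarrow> real"
  assumes "\<And>j. \<bar>s j - s (Suc j)\<bar> \<le> K * \<theta> ^ j" "0 < \<theta>" "\<theta> < 1"
  obtains L where "s \<longlonglongrightarrow> L" "\<bar>s 0 - L\<bar> \<le> K / (1 - \<theta>)" "\<bar>s 1 - L\<bar> \<le> K / (1 - \<theta>)"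
proof -
  have sumg: "(\<lambda>j. K * \<theta> ^ j) sums (K * (1 / (1 - \<theta>)))"
    using assms by (intro sums_mult geometric_sums) auto
  have summ: "summable (\<lambda>j. \<bar>s (Suc j) - s j\<bar>)"
    by (rule summable_comparison_test'[where N=0, OF sums_summable[OF sumg]])
       (use assms(1) in \<open>simp add: abs_minus_commute\<close>)
  then have summ': "summable (\<lambda>j. s (Suc j) - s j)" by (rule summable_rabs_cancel)
  define L where "L = s 0 + (\<Sum>j. s (Suc j) - s j)"
  have lim: "s \<longlonglongrightarrow> L"
  proof -
    have "(\<lambda>n. \<Sum>j<n. s (Suc j) - s j) \<longlonglongrightarrow> (\<Sum>j. s (Suc j) - s j)"
      using summ' by (rule summable_LIMSEQ)
    then have "(\<lambda>n. s 0 + (s n - s 0)) \<longlonglongrightarrow> L"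
      unfolding L_def by (intro tendsto_add tendsto_const) (simp add: sum_lessThan_telescope)
    then show ?thesis by simp
  qed
  have K: "0 \<le> K" using assms(1)[of 0] by simp
  have bound: "\<bar>s n - s m\<bar> \<le> K / (1 - \<theta>)" if "m \<le> n" for m n
  proof -
    have "s n - s m = (\<Sum>j=m..<n. s (Suc j) - s j)" using sum_Suc_diff'[OF that, of s] by simp
    then have "\<bar>s n - s m\<bar> \<le> (\<Sum>j=m..<n. \<bar>s (Suc j) - s j\<bar>)" by (simp add: sum_abs)
    also have "\<dots> \<le> (\<Sum>j=m..<n. K * \<theta> ^ j)"
      using assms(1) by (intro sum_mono) (simp add: abs_minus_commute)
    also have "\<dots> \<le> (\<Sum>j. K * \<theta> ^ j)"
      using sums_summable[OF sumg] K assms(2) by (intro sum_le_suminf) auto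
    also have "\<dots> = K / (1 - \<theta>)" using sums_unique[OF sumg] by simp
    finally show ?thesis .
  qed
  have "\<bar>s m - L\<bar> \<le> K / (1 - \<theta>)" for m
  proof -
    have "(\<lambda>n. \<bar>s m - s n\<bar>) \<longlonglongrightarrow> \<bar>s m - L\<bar>" by (intro tendsto_intros lim)
    then show ?thesis
      by (rule Lim_bounded[where M=m]) (simp add: abs_minus_commute bound)
  qed
  then show ?thesis using lim that by blast
qed

text \<open>The representative is a limit over the scales from 0 on, while the estimates begin at
  whichever scale they are available.\<close>

lemma LIMSEQ_int_shift:
  fixes s :: "int \<Rightarrow> 'a::topological_space"
  assumes "(\<lambda>j. s (a + int j)) \<longlonglongrightarrow> L"
  shows "(\<lambda>j. s (int j)) \<longlonglongrightarrow> L"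
proof -
  have "filterlim (\<lambda>j. nat (int j - a)) at_top sequentially"
    unfolding filterlim_at_top eventually_sequentially
  proof
    fix Z show "\<exists>N. \<forall>j\<ge>N. Z \<le> nat (int j - a)" by (intro exI[of _ "nat (a + int Z)"]) auto
  qed
  from filterlim_compose[OF assms this]
  have *: "(\<lambda>j. s (a + int (nat (int j - a)))) \<longlonglongrightarrow> L" .
  show ?thesis
  proof (rule Lim_transform_eventually[OF *])
    show "\<forall>\<^sub>F j in sequentially. s (a + int (nat (int j - a))) = s (int j)"
      unfolding eventually_sequentially by (intro exI[of _ "nat a"]) (auto simp: nat_le_iff)
  qed
qed

section \<open>Two measures on one space\<close>

text \<open>\<open>S\<close> will be the pulled-back measure and \<open>M\<close> the given one, of
  which only the growth of balls is recorded. Doubling and decay are conditional on a distance of at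
  least a quarter of the radius: in a bounded space all very large balls coincide, so unconditional
  decay would fail.\<close>

locale doubling_pair =
  fixes S M :: "'a::metric_space measure" and D R q c n p :: real
  assumes sets_S [measurable_cong]: "sets S = sets borel"
    and sets_M [measurable_cong]: "sets M = sets borel"
    and dist_measurable:
      "(\<lambda>z. dist (fst z) (snd z) :: real) \<in> borel_measurable (borel \<Otimes>\<^sub>M (borel :: 'a measure))"
    and S_finite: "\<And>x r. emeasure S (ball x r) < \<infinity>"
    and S_pos: "\<And>x r. 0 < r \<Longrightarrow> 0 < measure S (ball x r)"
    and doubling: "\<And>k a b x. 2 powr (- real_of_int k - 2) \<le> dist a (b::'a) \<Longrightarrow>
      measure S (ball x (2 powr (- real_of_int (k - 1)))) \<le> D * measure S (ball x (2 powr (- real_of_int k)))"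
    and decay: "\<And>k a b x j. 2 powr (- real_of_int k - 2) \<le> dist a (b::'a) \<Longrightarrow>
      measure S (ball x (2 powr (- real_of_int (k + int j)))) \<le> R * q ^ j * measure S (ball x (2 powr (- real_of_int k)))"
    and M_upper: "\<And>x r. 0 < r \<Longrightarrow> emeasure M (ball x r) \<le> ennreal (c * r powr n)"
    and params: "1 \<le> D" "0 < R" "0 < q" "q < 1" "0 < c" "0 < n" "1 \<le> p"
begin

abbreviation rad :: "int \<Rightarrow> real" where "rad k \<equiv> 2 powr (- real_of_int k)"

text \<open>The quarter radius is what makes scale \<open>k - 1\<close> good for two points at
  distance at least \<open>2 powr (- k - 1)\<close>; this is the coarsest scale used for their
  increment.\<close>

definition good :: "int \<Rightarrow> bool" where
  "good k \<longleftrightarrow> (\<exists>a b::'a. 2 powr (- real_of_int k - 2) \<le> dist a b)"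

definition bm :: "int \<Rightarrow> 'a \<Rightarrow> real" where "bm k x = measure S (ball x (rad k))"

text \<open>The indicator of a ball expressed through the distance, hence symmetric and jointly
  measurable in centre and point.\<close>

definition near :: "int \<Rightarrow> 'a \<Rightarrow> 'a \<Rightarrow> ennreal" where
  "near k x y = indicator {..<rad k} (dist x y)"

definition diffp :: "('a \<Rightarrow> real) \<Rightarrow> 'a \<Rightarrow> 'a \<Rightarrow> ennreal" where
  "diffp v y z = ennreal (\<bar>v y - v z\<bar> powr p)"

text \<open>The mean of \<open>diffp v\<close> over pairs of points of one ball. It is cut off at
  scales that are not good, where neither doubling nor decay is assumed.\<close>

definition osc :: "('a \<Rightarrow> real) \<Rightarrow> int \<Rightarrow> 'a \<Rightarrow> ennreal" where
  "osc v k x = (if good k then ennreal (1 / (bm k x)\<^sup>2) *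
     (\<integral>\<^sup>+ y. near k x y * (\<integral>\<^sup>+ z. near k x z * diffp v y z \<partial>S) \<partial>S) else 0)"

definition energy :: "('a \<Rightarrow> real) \<Rightarrow> ennreal" where
  "energy v = (\<integral>\<^sup>+ y. (\<integral>\<^sup>+ z. ennreal (\<bar>v y - v z\<bar> powr p / (measure S (ball y (dist y z)))\<^sup>2) \<partial>S) \<partial>S)"

lemma dist_measurable' [measurable (raw)]:
  assumes "f \<in> measurable N (borel :: 'a measure)" "g \<in> measurable N borel"
  shows "(\<lambda>x. dist (f x) (g x)) \<in> borel_measurable N"
  using measurable_compose[OF measurable_Pair[OF assms] dist_measurable] by simp

lemma near_measurable [measurable (raw)]:
  assumes [measurable]: "f \<in> measurable N (borel :: 'a measure)" "g \<in> measurable N borel"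
  shows "(\<lambda>x. near k (f x) (g x)) \<in> borel_measurable N"
  unfolding near_def by measurable

lemma M_finite: "emeasure M (ball x r) < \<infinity>"
proof (cases "0 < r")
  case True then show ?thesis using M_upper[OF True, of x] by (simp add: le_less_trans)
next
  case False then have "ball x r = {}" by simp
  then show ?thesis by (simp only: emeasure_empty) simp
qed

sublocale S: sigma_finite_measure S by (rule sigma_finite_of_balls[OF sets_S S_finite])
sublocale M: sigma_finite_measure M by (rule sigma_finite_of_balls[OF sets_M M_finite])
sublocale MS: pair_sigma_finite M S ..

lemma space_S [simp]: "space S = UNIV" using sets_eq_imp_space_eq[OF sets_S] by simp
lemma space_M [simp]: "space M = UNIV" using sets_eq_imp_space_eq[OF sets_M] by simp

lemma near_eq_indicator: "near k x y = indicator (ball x (rad k)) y"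
  unfolding near_def by (auto simp: indicator_def)

lemma near_commute: "near k x y = near k y x"
  unfolding near_def by (simp add: dist_commute)

lemma nn_integral_near: "(\<integral>\<^sup>+ y. near k x y \<partial>S) = ennreal (bm k x)"
  unfolding near_eq_indicator bm_def using S_finite[of x "rad k"]
  by (simp add: sets_S emeasure_eq_ennreal_measure less_top)

lemma bm_pos: "0 < bm k x"
  unfolding bm_def by (rule S_pos) simp

lemma bm_measurable [measurable]: "bm k \<in> borel_measurable borel"
proof -
  have "bm k = (\<lambda>x. enn2real (\<integral>\<^sup>+ y. near k x y \<partial>S))"
    using bm_pos by (auto simp: nn_integral_near less_imp_le)
  then show ?thesis by simp
qed

lemma diffp_measurable [measurable (raw)]:
  assumes [measurable]: "v \<in> borel_measurable borel" "f \<in> measurable N (borel :: 'a measure)" "g \<in> measurable N borel"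
  shows "(\<lambda>x. diffp v (f x) (g x)) \<in> borel_measurable N"
  unfolding diffp_def by measurable

lemma osc_measurable [measurable]:
  assumes [measurable]: "v \<in> borel_measurable borel"
  shows "osc v k \<in> borel_measurable borel"
  unfolding osc_def[abs_def] by measurable

lemma measure_ball_mono: "ball x r \<subseteq> ball y t \<Longrightarrow> measure S (ball x r) \<le> measure S (ball y t)"
  using S_finite by (intro measure_mono_fmeasurable) (auto simp: sets_S fmeasurable_def)

lemma good_mono: "good k \<Longrightarrow> k \<le> l \<Longrightarrow> good l"
  unfolding good_def by (meson order.trans powr_mono diff_right_mono le_imp_neg_le of_int_le_iff one_le_numeral)

lemma rad_pred: "rad (k - 1) = 2 * rad k"
proof -
  have "rad (k - 1) = 2 powr (1 + - real_of_int k)" by (rule arg_cong) simp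
  also have "\<dots> = 2 * rad k" by (subst powr_add) simp
  finally show ?thesis .
qed

lemma bm_doubling: "good k \<Longrightarrow> bm (k - 1) x \<le> D * bm k x"
  unfolding good_def bm_def using doubling by blast

lemma bm_decay: "good k \<Longrightarrow> bm (k + int j) x \<le> R * q ^ j * bm k x"
  unfolding good_def bm_def using decay by blast


lemma ball_measure_measurable [measurable (raw)]:
  assumes [measurable]: "f \<in> measurable N (borel :: 'a measure)" "g \<in> measurable N borel"
  shows "(\<lambda>x. measure S (ball (f x) (dist (f x) (g x)))) \<in> borel_measurable N"
proof -
  have "(\<lambda>x. measure S (ball (f x) (dist (f x) (g x)))) =
      (\<lambda>x. enn2real (\<integral>\<^sup>+ y. indicator {y. dist (f x) y < dist (f x) (g x)} y \<partial>S))"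
    by (simp add: ball_def sets_S Sigma_Algebra.measure_def)
  also have "\<dots> \<in> borel_measurable N" by measurable
  finally show ?thesis .
qed

section \<open>Oscillations summed over all scales against the energy\<close>

lemma bm_le_near:
  assumes "good k" "dist x y < rad k"
  shows "bm k y \<le> D * bm k x"
proof -
  have "ball y (rad k) \<subseteq> ball x (rad (k - 1))"
  proof
    fix z assume "z \<in> ball y (rad k)"
    then show "z \<in> ball x (rad (k - 1))"
      using assms(2) dist_triangle[of x z y] unfolding rad_pred by simp
  qed
  then have "bm k y \<le> bm (k - 1) x" unfolding bm_def by (rule measure_ball_mono)
  also have "\<dots> \<le> D * bm k x" by (rule bm_doubling[OF assms(1)])
  finally show ?thesis .
qed

lemma near_cases: "near k x y = 0 \<and> rad k \<le> dist x y \<or> near k x y = 1 \<and> dist x y < rad k"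
  unfolding near_def by (auto simp: indicator_def)

text \<open>Here the two measures meet. Tonelli puts y outermost; the x within \<open>rad k\<close>
  of y have M-mass at most \<open>c * rad k powr n\<close>, which cancels the weight. Two points of
  a ball about x are closer than \<open>2 * rad k\<close>, whence the coarser
  \<open>near (k - 1)\<close>.\<close>

lemma nn_integral_osc_le:
  assumes [measurable]: "v \<in> borel_measurable borel"
  shows "ennreal (rad k powr (- n)) * (\<integral>\<^sup>+ x. osc v k x \<partial>M) \<le>
    ennreal (c * D\<^sup>2) * (if good k then
      (\<integral>\<^sup>+ y. ennreal (1 / (bm k y)\<^sup>2) * (\<integral>\<^sup>+ z. near (k - 1) y z * diffp v y z \<partial>S) \<partial>S) else 0)"
proof (cases "good k")
  case False then show ?thesis by (simp add: osc_def)
next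
  case True
  \<comment> \<open>A majorant free of x: the square of \<open>bm_le_near\<close> replaces
    \<open>bm k x\<close> by \<open>bm k y\<close> at the cost of \<open>D\<^sup>2\<close>.\<close>
  define W where "W y = ennreal (D\<^sup>2 / (bm k y)\<^sup>2) * (\<integral>\<^sup>+ z. near (k - 1) y z * diffp v y z \<partial>S)" for y
  have [measurable]: "W \<in> borel_measurable borel" unfolding W_def[abs_def] by measurable
  have "osc v k x \<le> (\<integral>\<^sup>+ y. near k x y * W y \<partial>S)" for x
  proof -
    have "osc v k x = (\<integral>\<^sup>+ y. ennreal (1 / (bm k x)\<^sup>2) * (near k x y * (\<integral>\<^sup>+ z. near k x z * diffp v y z \<partial>S)) \<partial>S)"
      using True by (simp add: osc_def nn_integral_cmult)
    also have "\<dots> \<le> (\<integral>\<^sup>+ y. near k x y * W y \<partial>S)"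
    proof (rule nn_integral_mono)
      fix y
      show "ennreal (1 / (bm k x)\<^sup>2) * (near k x y * (\<integral>\<^sup>+ z. near k x z * diffp v y z \<partial>S)) \<le> near k x y * W y"
      proof (cases "dist x y < rad k")
        case False then show ?thesis using near_cases[of k x y] by auto
      next
        case d: True
        have "(\<integral>\<^sup>+ z. near k x z * diffp v y z \<partial>S) \<le> (\<integral>\<^sup>+ z. near (k - 1) y z * diffp v y z \<partial>S)"
        proof (intro nn_integral_mono mult_right_mono)
          fix z
          show "near k x z \<le> near (k - 1) y z"
            using d dist_triangle[of y z x] unfolding near_def rad_pred
            by (auto simp: indicator_def dist_commute)
        qed simp
        moreover have "ennreal (1 / (bm k x)\<^sup>2) \<le> ennreal (D\<^sup>2 / (bm k y)\<^sup>2)"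
        proof (rule ennreal_leI)
          have "(bm k y)\<^sup>2 \<le> (D * bm k x)\<^sup>2"
            using bm_le_near[OF True d] bm_pos[of k y] by (intro power_mono) auto
          then show "1 / (bm k x)\<^sup>2 \<le> D\<^sup>2 / (bm k y)\<^sup>2"
            using bm_pos[of k x] bm_pos[of k y] by (simp add: divide_simps power_mult_distrib)
        qed
        ultimately have "ennreal (1 / (bm k x)\<^sup>2) * (\<integral>\<^sup>+ z. near k x z * diffp v y z \<partial>S) \<le> W y"
          unfolding W_def by (intro mult_mono) auto
        then show ?thesis using d near_cases[of k x y] by auto
      qed
    qed
    finally show ?thesis .
  qed
  then have "(\<integral>\<^sup>+ x. osc v k x \<partial>M) \<le> (\<integral>\<^sup>+ x. (\<integral>\<^sup>+ y. near k x y * W y \<partial>S) \<partial>M)"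
    by (rule nn_integral_mono)
  also have "\<dots> = (\<integral>\<^sup>+ y. (\<integral>\<^sup>+ x. near k x y * W y \<partial>M) \<partial>S)"
    by (rule MS.Fubini'[symmetric]) measurable
  also have "\<dots> = (\<integral>\<^sup>+ y. W y * emeasure M (ball y (rad k)) \<partial>S)"
  proof (rule nn_integral_cong)
    fix y
    have "(\<integral>\<^sup>+ x. near k x y * W y \<partial>M) = (\<integral>\<^sup>+ x. W y * near k y x \<partial>M)"
      by (simp add: mult.commute near_commute)
    also have "\<dots> = W y * (\<integral>\<^sup>+ x. near k y x \<partial>M)"
      by (rule nn_integral_cmult) measurable
    finally show "(\<integral>\<^sup>+ x. near k x y * W y \<partial>M) = W y * emeasure M (ball y (rad k))"
      by (simp add: near_eq_indicator sets_M)
  qed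
  also have "\<dots> \<le> (\<integral>\<^sup>+ y. W y * ennreal (c * rad k powr n) \<partial>S)"
    by (intro nn_integral_mono mult_left_mono M_upper) auto
  also have "\<dots> = ennreal (c * rad k powr n) * (\<integral>\<^sup>+ y. W y \<partial>S)"
    by (subst nn_integral_multc) (auto simp: mult.commute)
  finally have "ennreal (rad k powr (- n)) * (\<integral>\<^sup>+ x. osc v k x \<partial>M) \<le>
      ennreal (rad k powr (- n)) * (ennreal (c * rad k powr n) * (\<integral>\<^sup>+ y. W y \<partial>S))"
    by (rule mult_left_mono) simp
  also have "\<dots> = ennreal c * (\<integral>\<^sup>+ y. W y \<partial>S)"
  proof -
    have "ennreal (rad k powr (- n)) * ennreal (c * rad k powr n) = ennreal (rad k powr (- n) * (c * rad k powr n))"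
      using params by (intro ennreal_mult[symmetric]) auto
    also have "rad k powr (- n) * (c * rad k powr n) = c" by (simp add: powr_minus)
    finally show ?thesis by (simp only: mult.assoc[symmetric])
  qed
  also have "(\<integral>\<^sup>+ y. W y \<partial>S) = (\<integral>\<^sup>+ y. ennreal (D\<^sup>2) * (ennreal (1 / (bm k y)\<^sup>2) *
      (\<integral>\<^sup>+ z. near (k - 1) y z * diffp v y z \<partial>S)) \<partial>S)"
    unfolding W_def by (simp add: mult.assoc[symmetric] ennreal_mult[symmetric])
  also have "\<dots> = ennreal (D\<^sup>2) * (\<integral>\<^sup>+ y. (ennreal (1 / (bm k y)\<^sup>2) *
      (\<integral>\<^sup>+ z. near (k - 1) y z * diffp v y z \<partial>S)) \<partial>S)"
    by (rule nn_integral_cmult) measurable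
  finally show ?thesis using True params by (simp add: ennreal_mult mult.assoc)
qed

text \<open>By the geometric decay of \<open>bm\<close>, the sum over all scales above
  \<open>dist y z\<close> is comparable to its largest term.\<close>

lemma scale_sum_le:
  "diffp v y z * (\<integral>\<^sup>+ k. (if good k then ennreal (1 / (bm k y)\<^sup>2) * near (k - 1) y z else 0) \<partial>count_space UNIV)
    \<le> ennreal ((D * R)\<^sup>2 / (1 - q\<^sup>2)) *
      ennreal (\<bar>v y - v z\<bar> powr p / (measure S (ball y (dist y z)))\<^sup>2)"
proof (cases "y = z")
  case True then show ?thesis using params by (simp add: diffp_def)
next
  case False
  then have "0 < dist y z" by simp
  then obtain m :: int where m: "2 powr (- real_of_int m - 1) \<le> dist y z" "dist y z < rad m"
    by (rule dyadic_scale_exists)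
  define s where "s = measure S (ball y (dist y z))"
  have s: "0 < s" unfolding s_def using False by (intro S_pos) simp
  define f where "f k = (if good k then ennreal (1 / (bm k y)\<^sup>2) * near (k - 1) y z else 0)" for k
  have good: "good (m + 1)"
    unfolding good_def using m(1) by (intro exI[of _ y] exI[of _ z]) (rule order.trans[rotated], assumption, simp)
  \<comment> \<open>The enlarged ball in \<open>near (k - 1)\<close> still lets scale
    \<open>m + 1\<close> contribute; finer scales do not see the pair.\<close>
  have f0: "f k = 0" if "m + 1 < k" for k
  proof -
    have "rad (k - 1) \<le> 2 powr (- real_of_int m - 1)" using that by (intro powr_mono) auto
    then have "near (k - 1) y z = 0" using m(1) near_cases[of "k - 1" y z] by linarith
    then show ?thesis unfolding f_def by simp
  qed
  \<comment> \<open>Decay is applied from the coarse scale \<open>m + 1 - int i\<close> down to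
    \<open>m + 1\<close>, whose ball has, up to \<open>D\<close>, at least the mass of the ball of
    radius \<open>dist y z\<close>. Squaring gives the ratio \<open>q\<^sup>2\<close> of the
    series.\<close>
  have fle: "f (m + 1 - int i) \<le> ennreal ((D * R)\<^sup>2 / s\<^sup>2 * (q\<^sup>2) ^ i)" for i
  proof (cases "good (m + 1 - int i)")
    case True
    have "s \<le> bm m y" unfolding s_def bm_def using m(2) by (intro measure_ball_mono) auto
    also have "\<dots> \<le> D * bm (m + 1) y" using bm_doubling[OF good, of y] by simp
    also have "bm (m + 1) y \<le> R * q ^ i * bm (m + 1 - int i) y"
      using bm_decay[OF True, of i y] by simp
    finally have "s \<le> D * (R * q ^ i * bm (m + 1 - int i) y)" using params by simp
    then have "s\<^sup>2 \<le> (D * (R * q ^ i * bm (m + 1 - int i) y))\<^sup>2"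
      using s by (intro power_mono) auto
    then have "1 / (bm (m + 1 - int i) y)\<^sup>2 \<le> (D * R)\<^sup>2 / s\<^sup>2 * (q\<^sup>2) ^ i"
      using s bm_pos[of "m + 1 - int i" y]
      by (simp add: divide_simps power_mult_distrib power_mult[symmetric] mult_ac)
    then show ?thesis using True near_cases[of "m + 1 - int i - 1" y z]
      unfolding f_def by (auto intro: ennreal_leI)
  qed (simp add: f_def)
  have q2: "norm (q\<^sup>2) < 1" using params by (simp add: power_less_one_iff)
  have "(\<integral>\<^sup>+ k. f k \<partial>count_space UNIV) = (\<Sum>i. f (m + 1 - int i))"
    by (rule nn_integral_int_reflect[OF f0])
  also have "\<dots> \<le> (\<Sum>i. ennreal ((D * R)\<^sup>2 / s\<^sup>2 * (q\<^sup>2) ^ i))"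
    using fle by (intro suminf_le) auto
  also have "\<dots> = ennreal ((D * R)\<^sup>2 / s\<^sup>2 * (1 / (1 - q\<^sup>2)))"
    using q2 by (intro suminf_ennreal_eq sums_mult geometric_sums) auto
  finally have "diffp v y z * (\<integral>\<^sup>+ k. f k \<partial>count_space UNIV) \<le>
      ennreal (\<bar>v y - v z\<bar> powr p) * ennreal ((D * R)\<^sup>2 / s\<^sup>2 * (1 / (1 - q\<^sup>2)))"
    unfolding diffp_def by (rule mult_left_mono) simp
  also have "\<dots> = ennreal ((D * R)\<^sup>2 / (1 - q\<^sup>2) * (\<bar>v y - v z\<bar> powr p / s\<^sup>2))"
    by (simp add: ennreal_mult'[symmetric] mult_ac)
  also have "\<dots> = ennreal ((D * R)\<^sup>2 / (1 - q\<^sup>2)) * ennreal (\<bar>v y - v z\<bar> powr p / s\<^sup>2)"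
    using q2 by (intro ennreal_mult) auto
  finally show ?thesis unfolding f_def s_def .
qed

text \<open>Tonelli moves the sum over scales innermost, where \<open>scale_sum_le\<close> evaluates
  it for each pair of points separately.\<close>

lemma total_oscillation_le:
  assumes [measurable]: "v \<in> borel_measurable borel"
  shows "(\<integral>\<^sup>+ k. ennreal (rad k powr (- n)) * (\<integral>\<^sup>+ x. osc v k x \<partial>M) \<partial>count_space UNIV) \<le>
    ennreal (c * D\<^sup>2) * (ennreal ((D * R)\<^sup>2 / (1 - q\<^sup>2)) * energy v)"
proof -
  let ?w = "\<lambda>k y. if good k then ennreal (1 / (bm k y)\<^sup>2) else 0"
  have "(\<integral>\<^sup>+ k. ennreal (rad k powr (- n)) * (\<integral>\<^sup>+ x. osc v k x \<partial>M) \<partial>count_space UNIV) \<le>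
      (\<integral>\<^sup>+ k. ennreal (c * D\<^sup>2) * (\<integral>\<^sup>+ y. (\<integral>\<^sup>+ z. ?w k y * (near (k - 1) y z * diffp v y z) \<partial>S) \<partial>S)
        \<partial>count_space UNIV)"
  proof (rule nn_integral_mono)
    fix k
    show "ennreal (rad k powr (- n)) * (\<integral>\<^sup>+ x. osc v k x \<partial>M) \<le>
      ennreal (c * D\<^sup>2) * (\<integral>\<^sup>+ y. (\<integral>\<^sup>+ z. ?w k y * (near (k - 1) y z * diffp v y z) \<partial>S) \<partial>S)"
      using nn_integral_osc_le[OF assms, of k] by (simp add: nn_integral_cmult split: if_splits)
  qed
  also have "\<dots> = ennreal (c * D\<^sup>2) * (\<integral>\<^sup>+ k. (\<integral>\<^sup>+ y. (\<integral>\<^sup>+ z. ?w k y * (near (k - 1) y z * diffp v y z) \<partial>S) \<partial>S)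
        \<partial>count_space UNIV)"
    by (rule nn_integral_cmult) simp
  also have "(\<integral>\<^sup>+ k. (\<integral>\<^sup>+ y. (\<integral>\<^sup>+ z. ?w k y * (near (k - 1) y z * diffp v y z) \<partial>S) \<partial>S) \<partial>count_space UNIV)
      = (\<integral>\<^sup>+ y. (\<integral>\<^sup>+ k. (\<integral>\<^sup>+ z. ?w k y * (near (k - 1) y z * diffp v y z) \<partial>S) \<partial>count_space UNIV) \<partial>S)"
    by (rule nn_integral_int_swap[symmetric]) measurable
  also have "\<dots> = (\<integral>\<^sup>+ y. (\<integral>\<^sup>+ z. (\<integral>\<^sup>+ k. ?w k y * (near (k - 1) y z * diffp v y z) \<partial>count_space UNIV) \<partial>S) \<partial>S)"
    by (intro nn_integral_cong nn_integral_int_swap[symmetric]) measurable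
  also have "\<dots> = (\<integral>\<^sup>+ y. (\<integral>\<^sup>+ z. diffp v y z *
      (\<integral>\<^sup>+ k. (if good k then ennreal (1 / (bm k y)\<^sup>2) * near (k - 1) y z else 0) \<partial>count_space UNIV) \<partial>S) \<partial>S)"
    by (subst nn_integral_cmult[symmetric]) (auto intro!: nn_integral_cong simp: mult_ac)
  also have "\<dots> \<le> (\<integral>\<^sup>+ y. (\<integral>\<^sup>+ z. ennreal ((D * R)\<^sup>2 / (1 - q\<^sup>2)) *
      ennreal (\<bar>v y - v z\<bar> powr p / (measure S (ball y (dist y z)))\<^sup>2) \<partial>S) \<partial>S)"
    by (intro nn_integral_mono scale_sum_le)
  also have "\<dots> = ennreal ((D * R)\<^sup>2 / (1 - q\<^sup>2)) * energy v"
    unfolding energy_def by (simp add: nn_integral_cmult)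
  finally show ?thesis by (simp add: mult_left_mono)
qed

end

lemma ennreal_mult_3:
  assumes "0 \<le> a" "0 \<le> b" "0 \<le> d"
  shows "ennreal a * (ennreal b * (ennreal d * X)) = ennreal (a * (b * d)) * X"
  using assms by (simp add: ennreal_mult mult.assoc)

section \<open>Limits of averages and their increments at individual points\<close>

context doubling_pair begin

definition mean :: "('a \<Rightarrow> real) \<Rightarrow> int \<Rightarrow> 'a \<Rightarrow> real" where
  "mean v k x = (\<integral> y. indicator (ball x (rad k)) y * v y \<partial>S) / bm k x"

text \<open>\<open>lim\<close> is total. Convergence is established only at points where
  \<open>grad_pow\<close> is finite at a suitable scale, or where the inner integral of the energy
  is finite.\<close>

definition repr :: "('a \<Rightarrow> real) \<Rightarrow> 'a \<Rightarrow> real" where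
  "repr v x = lim (\<lambda>j. mean v (int j) x)"

lemma mean_measurable [measurable]:
  assumes [measurable]: "v \<in> borel_measurable borel"
  shows "mean v k \<in> borel_measurable borel"
proof -
  have "(\<integral> y. indicator (ball x (rad k)) y * v y \<partial>S) = (\<integral> y. indicator {..<rad k} (dist x y) * v y \<partial>S)" for x
    by (intro Bochner_Integration.integral_cong) (auto simp: indicator_def)
  then have "mean v k = (\<lambda>x. (\<integral> y. indicator {..<rad k} (dist x y) * v y \<partial>S) / bm k x)"
    unfolding mean_def by auto
  then show ?thesis by simp
qed

lemma repr_measurable [measurable]:
  assumes [measurable]: "v \<in> borel_measurable borel"
  shows "repr v \<in> borel_measurable borel"
  unfolding repr_def[abs_def] by (rule borel_measurable_lim_metric) measurable

lemma mean_close: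
  assumes [measurable]: "v \<in> borel_measurable borel" and "0 < l"
    and "(\<integral>\<^sup>+ z. near k x z * ennreal (\<bar>v z - e\<bar> powr p) \<partial>S) \<le> ennreal (bm k x * l powr p)"
  shows "\<bar>mean v k x - e\<bar> \<le> 2 * l"
  unfolding mean_def bm_def
proof (rule average_close[where p=p])
  show "(\<integral>\<^sup>+ y. indicator (ball x (rad k)) y * ennreal (\<bar>v y - e\<bar> powr p) \<partial>S)
      \<le> ennreal (measure S (ball x (rad k)) * l powr p)"
    using assms(3) unfolding near_eq_indicator bm_def .
qed (use assms(2) params bm_pos[of k x] S_finite in \<open>simp_all add: sets_S bm_def\<close>)

text \<open>By Chebyshev some value \<open>v y\<close> is close in p-th mean to \<open>v\<close> on
  the larger ball. Both averages are compared with this number; the smaller ball, which may have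
  another centre, loses only the mass ratio \<open>D'\<close>.\<close>

lemma mean_diff_le:
  assumes [measurable]: "v \<in> borel_measurable borel" and "0 < l" and good: "good k"
    and osc: "osc v k x \<le> ennreal (l powr p)"
    and sub: "ball x' (rad k') \<subseteq> ball x (rad k)" and D': "1 \<le> D'" "bm k x \<le> D' * bm k' x'"
  shows "\<bar>mean v k x - mean v k' x'\<bar> \<le> 8 * D' * l"
proof -
  let ?b = "bm k x"
  have b: "0 < ?b" by (rule bm_pos)
  have lp: "0 < l powr p" using \<open>0 < l\<close> by simp
  \<comment> \<open>The factor 2 is the slack for the contradiction: if no y satisfied this, the
    mean oscillation would be at least \<open>2 * l powr p\<close>.\<close>
  obtain y where y: "(\<integral>\<^sup>+ z. near k x z * diffp v y z \<partial>S) \<le> ennreal (2 * ?b * l powr p)"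
  proof (rule ccontr)
    assume "\<not> thesis"
    with that have big: "ennreal (2 * ?b * l powr p) \<le> (\<integral>\<^sup>+ z. near k x z * diffp v y z \<partial>S)" for y
      by (meson le_cases)
    have "ennreal (2 * l powr p) = ennreal (1 / ?b\<^sup>2) * (ennreal ?b * ennreal (2 * ?b * l powr p))"
      using b by (simp add: ennreal_mult'[symmetric] power2_eq_square field_simps)
    also have "ennreal ?b * ennreal (2 * ?b * l powr p) = (\<integral>\<^sup>+ y. near k x y * ennreal (2 * ?b * l powr p) \<partial>S)"
      by (simp add: nn_integral_multc nn_integral_near)
    also have "\<dots> \<le> (\<integral>\<^sup>+ y. near k x y * (\<integral>\<^sup>+ z. near k x z * diffp v y z \<partial>S) \<partial>S)"
      by (intro nn_integral_mono mult_left_mono big) simp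
    finally have "ennreal (2 * l powr p) \<le> osc v k x"
      using good unfolding osc_def by (simp add: mult_left_mono)
    then have "ennreal (2 * l powr p) \<le> ennreal (l powr p)" using osc by order
    then show False using lp by (subst (asm) ennreal_le_iff) auto
  qed
  \<comment> \<open>Since p is at least 1, \<open>(2 * E) powr p\<close> absorbs both the slack 2
    and the mass ratio \<open>E\<close>; the outer 2 is that of \<open>average_close\<close>. The
    larger ball itself is the case \<open>E = 1\<close>.\<close>
  have *: "\<bar>mean v k'' x'' - v y\<bar> \<le> 2 * (2 * E * l)"
    if "ball x'' (rad k'') \<subseteq> ball x (rad k)" "1 \<le> E" "bm k x \<le> E * bm k'' x''" for x'' k'' E
  proof (rule mean_close)
    have "(\<integral>\<^sup>+ z. near k'' x'' z * ennreal (\<bar>v z - v y\<bar> powr p) \<partial>S) \<le> (\<integral>\<^sup>+ z. near k x z * diffp v y z \<partial>S)"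
      using that(1) by (intro nn_integral_mono)
        (auto simp: near_eq_indicator diffp_def indicator_def abs_minus_commute)
    also have "\<dots> \<le> ennreal (2 * ?b * l powr p)" by (rule y)
    also have "\<dots> \<le> ennreal (bm k'' x'' * (2 * E * l) powr p)"
    proof (rule ennreal_leI)
      have "2 * E \<le> (2 * E) powr p"
        using that(2) params powr_mono[of 1 p "2 * E"] by simp
      then have "2 * E * l powr p \<le> (2 * E * l) powr p"
        using that(2) \<open>0 < l\<close> by (simp add: powr_mult mult_right_mono)
      then have "bm k'' x'' * (2 * E * l powr p) \<le> bm k'' x'' * (2 * E * l) powr p"
        using bm_pos[of k'' x''] by (intro mult_left_mono) auto
      moreover have "2 * ?b * l powr p \<le> 2 * (E * bm k'' x'') * l powr p"
        using that(3) by (intro mult_right_mono mult_left_mono) auto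
      ultimately show "2 * ?b * l powr p \<le> bm k'' x'' * (2 * E * l) powr p" by (simp add: mult_ac)
    qed
    finally show "(\<integral>\<^sup>+ z. near k'' x'' z * ennreal (\<bar>v z - v y\<bar> powr p) \<partial>S)
      \<le> ennreal (bm k'' x'' * (2 * E * l) powr p)" .
  qed (use that \<open>0 < l\<close> in auto)
  have "\<bar>mean v k x - v y\<bar> \<le> 4 * l" using *[of x k 1] by simp
  moreover have "4 * l \<le> 4 * D' * l" using D'(1) \<open>0 < l\<close> by simp
  moreover have "\<bar>mean v k' x' - v y\<bar> \<le> 4 * D' * l" using *[OF sub D'] by simp
  ultimately show ?thesis by linarith
qed

text \<open>A weight \<open>2 powr (a * j)\<close> on the j-th finer oscillation makes the
  increments decay if a is positive, and keeps the total over all scales finite if a is below n. The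
  choice a = n / 2 splits the exponent evenly, and
  \<open>\<theta> powr p = 2 powr (- n / 2)\<close>.\<close>

definition \<theta> :: real where "\<theta> = 2 powr (- n / (2 * p))"

text \<open>Up to \<kappa> and a power of the scale, the p-th power of the future gradient. Summing
  the oscillations themselves rather than their p-th roots keeps the integral additive, and each
  term is still dominated by the sum. It starts at \<open>k - 1\<close> so that the first ball about
  x covers the ball of radius \<open>rad k\<close> about a neighbour.\<close>

definition grad_pow :: "('a \<Rightarrow> real) \<Rightarrow> int \<Rightarrow> 'a \<Rightarrow> ennreal" where
  "grad_pow v k x = (\<Sum>j. ennreal (2 powr (n / 2 * real j)) * osc v (k - 1 + int j) x)"

text \<open>Two telescoped tails, one for each point, and one jump between the points.\<close>

definition \<kappa> :: real where "\<kappa> = 16 * D / (1 - \<theta>) + 8 * D\<^sup>2"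

lemma \<theta>: "0 < \<theta>" "\<theta> < 1"
  unfolding \<theta>_def using params powr_less_mono[of "- n / (2 * p)" 0 2] by auto

lemma \<kappa>: "0 < \<kappa>"
  unfolding \<kappa>_def using \<theta> params by (intro add_pos_pos) auto

lemma grad_pow_measurable [measurable]:
  assumes [measurable]: "v \<in> borel_measurable borel"
  shows "grad_pow v k \<in> borel_measurable borel"
  unfolding grad_pow_def[abs_def] by measurable

lemma osc_le_grad_pow:
  assumes "grad_pow v k x \<le> ennreal (l powr p)" "0 < l"
  shows "osc v (k - 1 + int j) x \<le> ennreal ((\<theta> ^ j * l) powr p)"
proof -
  have th: "(\<theta> ^ j) powr p = 2 powr (- (n / 2 * real j))"
    unfolding \<theta>_def using params by (simp add: powr_realpow[symmetric] powr_powr)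
  have "ennreal (2 powr (n / 2 * real j)) * osc v (k - 1 + int j) x \<le> grad_pow v k x"
    unfolding grad_pow_def
    using sum_le_suminf[of "\<lambda>j. ennreal (2 powr (n / 2 * real j)) * osc v (k - 1 + int j) x" "{j}"] by simp
  also note assms(1)
  finally have "ennreal ((\<theta> ^ j) powr p) * (ennreal (2 powr (n / 2 * real j)) * osc v (k - 1 + int j) x)
      \<le> ennreal ((\<theta> ^ j) powr p) * ennreal (l powr p)" by (rule mult_left_mono) simp
  also have "ennreal ((\<theta> ^ j) powr p) * (ennreal (2 powr (n / 2 * real j)) * osc v (k - 1 + int j) x) =
      osc v (k - 1 + int j) x"
    unfolding th by (simp add: mult.assoc[symmetric] ennreal_mult[symmetric] powr_minus)
  also have "ennreal ((\<theta> ^ j) powr p) * ennreal (l powr p) = ennreal ((\<theta> ^ j * l) powr p)"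
    using assms(2) \<theta> by (simp add: powr_mult ennreal_mult)
  finally show ?thesis .
qed

text \<open>Telescoping: by \<open>mean_diff_le\<close> consecutive averages differ by at most
  \<open>8 * D * \<theta> ^ j * l\<close>. The argument works at each single point that meets the
  bound.\<close>

lemma repr_close:
  assumes [measurable]: "v \<in> borel_measurable borel" and good: "good (k - 1)"
    and l: "grad_pow v k x \<le> ennreal (l powr p)" "0 < l"
  shows "\<bar>mean v (k - 1) x - repr v x\<bar> \<le> 8 * D / (1 - \<theta>) * l"
    and "\<bar>mean v k x - repr v x\<bar> \<le> 8 * D / (1 - \<theta>) * l"
proof -
  let ?s = "\<lambda>j. mean v (k - 1 + int j) x"
  have "\<bar>?s j - ?s (Suc j)\<bar> \<le> (8 * D * l) * \<theta> ^ j" for j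
  proof -
    have g: "good (k - 1 + int j)" "good (k - 1 + int (Suc j))" by (rule good_mono[OF good], simp)+
    have "\<bar>?s j - ?s (Suc j)\<bar> \<le> 8 * D * (\<theta> ^ j * l)"
    proof (rule mean_diff_le[OF assms(1) _ g(1)])
      show "osc v (k - 1 + int j) x \<le> ennreal ((\<theta> ^ j * l) powr p)" by (rule osc_le_grad_pow[OF l])
      show "bm (k - 1 + int j) x \<le> D * bm (k - 1 + int (Suc j)) x"
        using bm_doubling[OF g(2), of x] by (simp add: algebra_simps)
      show "ball x (rad (k - 1 + int (Suc j))) \<subseteq> ball x (rad (k - 1 + int j))"
        by (intro subset_ball powr_mono) auto
    qed (use \<theta> l params in auto)
    then show ?thesis by (simp add: mult_ac)
  qed
  from geometric_increments_convergent[OF this \<theta>] obtain L where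
    L: "?s \<longlonglongrightarrow> L" "\<bar>?s 0 - L\<bar> \<le> 8 * D * l / (1 - \<theta>)" "\<bar>?s 1 - L\<bar> \<le> 8 * D * l / (1 - \<theta>)" by blast
  have "repr v x = L" unfolding repr_def
    by (rule limI) (rule LIMSEQ_int_shift[OF L(1)])
  then show "\<bar>mean v (k - 1) x - repr v x\<bar> \<le> 8 * D / (1 - \<theta>) * l"
    and "\<bar>mean v k x - repr v x\<bar> \<le> 8 * D / (1 - \<theta>) * l"
    using L(2,3) by simp_all
qed

text \<open>The chain runs from \<open>repr v x\<close> to the average at scale \<open>k - 1\<close>
  about x, across to the average at scale k about y, and on to \<open>repr v y\<close>. One l has to
  serve both points.\<close>

lemma repr_diff_le:
  assumes [measurable]: "v \<in> borel_measurable borel"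
    and d: "2 powr (- real_of_int k - 1) \<le> dist x y" "dist x y < rad k"
    and l: "grad_pow v k x \<le> ennreal (l powr p)" "grad_pow v k y \<le> ennreal (l powr p)" "0 < l"
  shows "\<bar>repr v x - repr v y\<bar> \<le> \<kappa> * l"
proof -
  have "2 powr (- real_of_int (k - 1) - 2) = 2 powr (- real_of_int k - 1)" by (rule arg_cong) simp
  then have good: "good (k - 1)" unfolding good_def using d(1) by metis
  then have goodk: "good k" by (rule good_mono) simp
  have "\<bar>mean v (k - 1) x - mean v k y\<bar> \<le> 8 * D\<^sup>2 * l"
  proof (rule mean_diff_le[OF assms(1) l(3) good])
    show "osc v (k - 1) x \<le> ennreal (l powr p)" using osc_le_grad_pow[OF l(1,3), of 0] by simp
    show "ball y (rad k) \<subseteq> ball x (rad (k - 1))"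
    proof
      fix z assume "z \<in> ball y (rad k)"
      then show "z \<in> ball x (rad (k - 1))"
        using d(2) dist_triangle[of x z y] unfolding rad_pred by simp
    qed
    show "1 \<le> D\<^sup>2" using params by (simp add: one_le_power)
    have "rad k \<le> rad (k - 1)" by (intro powr_mono) auto
    then have "dist y x < rad (k - 1)" using d(2) dist_commute[of y x] by linarith
    \<comment> \<open>One factor \<open>D\<close> pays for moving the centre, a second one for
      halving the radius.\<close>
    then have "bm (k - 1) x \<le> D * bm (k - 1) y" by (rule bm_le_near[OF good])
    also have "\<dots> \<le> D * (D * bm k y)" using bm_doubling[OF goodk, of y] params by simp
    finally show "bm (k - 1) x \<le> D\<^sup>2 * bm k y" by (simp add: power2_eq_square mult.assoc)
  qed
  moreover note repr_close(1)[OF assms(1) good l(1,3)] repr_close(2)[OF assms(1) good l(2,3)]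
  moreover have "\<kappa> * l = 8 * D / (1 - \<theta>) * l + 8 * D / (1 - \<theta>) * l + 8 * D\<^sup>2 * l"
    unfolding \<kappa>_def by (simp add: algebra_simps add_divide_distrib[symmetric])
  ultimately show ?thesis by linarith
qed

text \<open>Relative to its own scale \<open>k - 1 + int j\<close>, the j-th oscillation carries the
  weight \<open>2 powr n * t ^ j\<close> with \<open>t = 2 powr (- n / 2)\<close>. As the scales
  range over all integers, shifting them changes nothing, and a geometric series remains.\<close>

lemma total_grad_pow_le:
  assumes [measurable]: "v \<in> borel_measurable borel"
  shows "(\<integral>\<^sup>+ k. ennreal (rad k powr (- n)) * (\<integral>\<^sup>+ x. grad_pow v k x \<partial>M) \<partial>count_space UNIV) \<le>
    ennreal (2 powr n / (1 - 2 powr (- n / 2))) *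
      (\<integral>\<^sup>+ k. ennreal (rad k powr (- n)) * (\<integral>\<^sup>+ x. osc v k x \<partial>M) \<partial>count_space UNIV)"
proof -
  define A where "A k = ennreal (rad k powr (- n)) * (\<integral>\<^sup>+ x. osc v k x \<partial>M)" for k
  define t where "t = 2 powr (- n / 2)"
  have t: "0 < t" "t < 1" unfolding t_def using params powr_less_mono[of "- n / 2" 0 2] by auto
  have tj: "t ^ j = 2 powr (- (n / 2 * real j))" for j
    unfolding t_def by (simp add: powr_realpow[symmetric] powr_powr)
  have scale: "ennreal (rad k powr (- n)) * (ennreal (2 powr (n / 2 * real j)) * (\<integral>\<^sup>+ x. osc v (k - 1 + int j) x \<partial>M))
      = ennreal (2 powr n * t ^ j) * A (k + (int j - 1))" for k j
  proof -
    have "rad k powr (- n) * 2 powr (n / 2 * real j) = 2 powr n * t ^ j * rad (k + (int j - 1)) powr (- n)"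
      unfolding tj by (simp add: powr_powr powr_add[symmetric] algebra_simps)
    then have "ennreal (rad k powr (- n)) * ennreal (2 powr (n / 2 * real j)) =
        ennreal (2 powr n * t ^ j) * ennreal (rad (k + (int j - 1)) powr (- n))"
      using t by (simp add: ennreal_mult[symmetric])
    moreover have "k - 1 + int j = k + (int j - 1)" by simp
    ultimately show ?thesis unfolding A_def by (simp only: mult.assoc[symmetric])
  qed
  have "ennreal (rad k powr (- n)) * (\<integral>\<^sup>+ x. grad_pow v k x \<partial>M) =
      (\<Sum>j. ennreal (2 powr n * t ^ j) * A (k + (int j - 1)))" for k
    unfolding grad_pow_def scale[symmetric]
    by (subst nn_integral_suminf) (auto simp: nn_integral_cmult ennreal_suminf_cmult)
  then have "(\<integral>\<^sup>+ k. ennreal (rad k powr (- n)) * (\<integral>\<^sup>+ x. grad_pow v k x \<partial>M) \<partial>count_space UNIV) =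
      (\<Sum>j. \<integral>\<^sup>+ k. ennreal (2 powr n * t ^ j) * A (k + (int j - 1)) \<partial>count_space UNIV)"
    by (simp add: nn_integral_suminf)
  also have "\<dots> = (\<Sum>j. ennreal (2 powr n * t ^ j) * (\<integral>\<^sup>+ k. A k \<partial>count_space UNIV))"
    by (simp add: nn_integral_cmult nn_integral_int_shift)
  also have "\<dots> = (\<Sum>j. ennreal (2 powr n * t ^ j)) * (\<integral>\<^sup>+ k. A k \<partial>count_space UNIV)"
    by simp
  also have "(\<Sum>j. ennreal (2 powr n * t ^ j)) = ennreal (2 powr n * (1 / (1 - t)))"
    using t by (intro suminf_ennreal_eq sums_mult geometric_sums) auto
  finally show ?thesis unfolding A_def t_def by simp
qed

section \<open>The fractional gradient of the limit, and its agreement with the original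
  function\<close>

definition hajlasz_const :: real where
  "hajlasz_const = \<kappa> powr p * 2 powr n * (2 powr n / (1 - 2 powr (- n / 2))) *
    (c * D\<^sup>2 * ((D * R)\<^sup>2 / (1 - q\<^sup>2)))"

lemma hajlasz_repr_le:
  assumes [measurable]: "v \<in> borel_measurable borel" and fin: "energy v < \<infinity>"
  shows "hajlasz_besov_pow M (n / p) p (repr v) \<le> ennreal hajlasz_const * energy v"
proof -
  define T where "T = (\<integral>\<^sup>+ k. ennreal (rad k powr (- n)) * (\<integral>\<^sup>+ x. grad_pow v k x \<partial>M) \<partial>count_space UNIV)"
  have q2: "q\<^sup>2 < 1" using params by (simp add: power_less_one_iff)
  have t1: "2 powr (- n / 2) < 1" using params powr_less_mono[of "- n / 2" 0 2] by simp
  have "T \<le> ennreal (2 powr n / (1 - 2 powr (- n / 2))) *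
      (ennreal (c * D\<^sup>2) * (ennreal ((D * R)\<^sup>2 / (1 - q\<^sup>2)) * energy v))"
    unfolding T_def by (rule order.trans[OF total_grad_pow_le[OF assms(1)]])
      (intro mult_left_mono total_oscillation_le assms(1), simp)
  also have "\<dots> = ennreal ((2 powr n / (1 - 2 powr (- n / 2))) * (c * D\<^sup>2 * ((D * R)\<^sup>2 / (1 - q\<^sup>2)))) * energy v"
    using q2 t1 params by (intro ennreal_mult_3) auto
  finally have T: "T \<le> ennreal ((2 powr n / (1 - 2 powr (- n / 2))) * (c * D\<^sup>2 * ((D * R)\<^sup>2 / (1 - q\<^sup>2)))) * energy v" .
  have Tfin: "T < \<infinity>" by (rule le_less_trans[OF T]) (use fin in \<open>simp add: ennreal_mult_less_top\<close>)
  \<comment> \<open>\<open>enn2real\<close> sends infinity to 0, so points with an infinite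
    \<open>grad_pow\<close> must go into the exceptional set; finiteness of \<open>T\<close> makes
    that set M-null.\<close>
  have "AE x in M. \<forall>k. grad_pow v k x < \<infinity>"
  proof (rule AE_all_countable[THEN iffD2], rule allI)
    fix k
    have "ennreal (rad k powr (- n)) * (\<integral>\<^sup>+ x. grad_pow v k x \<partial>M) \<le> T"
      unfolding T_def by (rule nn_integral_ge_point) simp
    then have "ennreal (rad k powr (- n)) * (\<integral>\<^sup>+ x. grad_pow v k x \<partial>M) < \<infinity>" using Tfin by order
    then have "(\<integral>\<^sup>+ x. grad_pow v k x \<partial>M) \<noteq> \<infinity>" by (auto simp: ennreal_mult_less_top)
    then have "AE x in M. grad_pow v k x \<noteq> \<infinity>" by (intro nn_integral_PInf_AE) measurable
    then show "AE x in M. grad_pow v k x < \<infinity>" by eventually_elim (simp add: less_top)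
  qed
  then obtain E where E: "E \<in> null_sets M" "\<And>x k. x \<notin> E \<Longrightarrow> grad_pow v k x < \<infinity>"
    by (rule AE_E3) auto
  \<comment> \<open>\<open>rad (k + 1)\<close> is the lower end of the k-th dyadic shell, so its
    negative power is compensated by the power of the distance in the gradient inequality.\<close>
  define g where "g k x = \<kappa> * rad (k + 1) powr (- (n / p)) * enn2real (grad_pow v k x) powr (1 / p)" for k x
  have g0: "0 \<le> g k x" for k x unfolding g_def using \<kappa> by simp
  have "g \<in> frac_hajlasz_grad M (n / p) (repr v)"
    unfolding frac_hajlasz_grad_def
  proof (intro CollectI conjI allI bexI[OF _ E(1)] impI)
    show "g k \<in> borel_measurable M" for k unfolding g_def[abs_def] by measurable
    show "0 \<le> g k x" for k x by (rule g0)
    fix k x y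
    assume *: "x \<notin> E \<and> y \<notin> E \<and> 2 powr (- real_of_int k - 1) \<le> dist x y \<and> dist x y < rad k"
    define X where "X = enn2real (grad_pow v k x) powr (1 / p)"
    define Y where "Y = enn2real (grad_pow v k y) powr (1 / p)"
    have XY: "0 \<le> X" "0 \<le> Y" unfolding X_def Y_def by auto
    have le: "grad_pow v k w \<le> ennreal (l powr p)"
      if "w \<notin> E" "enn2real (grad_pow v k w) powr (1 / p) \<le> l" for w l
    proof -
      have "grad_pow v k w = ennreal (enn2real (grad_pow v k w))" using E(2)[OF that(1)] by simp
      also have "enn2real (grad_pow v k w) = (enn2real (grad_pow v k w) powr (1 / p)) powr p"
        using params by (simp add: powr_powr)
      also have "ennreal \<dots> \<le> ennreal (l powr p)"
        using that(2) params by (intro ennreal_leI powr_mono2) auto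
      finally show ?thesis .
    qed
    \<comment> \<open>\<open>repr_diff_le\<close> wants a positive l, whereas \<open>X + Y\<close>
      may vanish.\<close>
    have "\<bar>repr v x - repr v y\<bar> \<le> \<kappa> * (X + Y)"
    proof (rule field_le_epsilon)
      fix \<epsilon> :: real assume \<epsilon>: "0 < \<epsilon>"
      have "\<bar>repr v x - repr v y\<bar> \<le> \<kappa> * (X + Y + \<epsilon> / \<kappa>)"
      proof (rule repr_diff_le[where k=k])
        have e: "0 < \<epsilon> / \<kappa>" using \<epsilon> \<kappa> by simp
        show "grad_pow v k x \<le> ennreal ((X + Y + \<epsilon> / \<kappa>) powr p)"
          using * XY e by (intro le) (auto simp: X_def)
        show "grad_pow v k y \<le> ennreal ((X + Y + \<epsilon> / \<kappa>) powr p)"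
          using * XY e by (intro le) (auto simp: Y_def)
        show "0 < X + Y + \<epsilon> / \<kappa>" using XY e by simp
      qed (use * in auto)
      also have "\<dots> = \<kappa> * (X + Y) + \<epsilon>" using \<kappa> by (simp add: distrib_left)
      finally show "\<bar>repr v x - repr v y\<bar> \<le> \<kappa> * (X + Y) + \<epsilon>" .
    qed
    also have "\<dots> \<le> (dist x y powr (n / p) * rad (k + 1) powr (- (n / p))) * (\<kappa> * (X + Y))"
    proof -
      have "rad (k + 1) = 2 powr (- real_of_int k - 1)" by (rule arg_cong) simp
      then have "rad (k + 1) powr (n / p) \<le> dist x y powr (n / p)"
        using * params by (intro powr_mono2) auto
      then have "1 \<le> dist x y powr (n / p) * rad (k + 1) powr (- (n / p))"
        by (subst powr_minus_divide) (simp add: field_simps)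
      then have "1 * (\<kappa> * (X + Y)) \<le> (dist x y powr (n / p) * rad (k + 1) powr (- (n / p))) * (\<kappa> * (X + Y))"
        using \<kappa> XY by (intro mult_right_mono mult_nonneg_nonneg add_nonneg_nonneg) auto
      then show ?thesis by (simp only: mult_1)
    qed
    also have "\<dots> = dist x y powr (n / p) * (g k x + g k y)"
      unfolding g_def X_def Y_def by (simp add: algebra_simps)
    finally show "\<bar>repr v x - repr v y\<bar> \<le> dist x y powr (n / p) * (g k x + g k y)" .
  qed
  then have "hajlasz_besov_pow M (n / p) p (repr v) \<le>
      (\<integral>\<^sup>+ x. (\<integral>\<^sup>+ k. ennreal (g k x powr p) \<partial>count_space UNIV) \<partial>M)"
    unfolding hajlasz_besov_pow_def by (rule INF_lower)
  also have "\<dots> = (\<integral>\<^sup>+ k. (\<integral>\<^sup>+ x. ennreal (g k x powr p) \<partial>M) \<partial>count_space UNIV)"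
    by (rule nn_integral_int_swap) (simp add: g_def[abs_def])
  also have "\<dots> \<le> (\<integral>\<^sup>+ k. ennreal (\<kappa> powr p * 2 powr n) *
      (ennreal (rad k powr (- n)) * (\<integral>\<^sup>+ x. grad_pow v k x \<partial>M)) \<partial>count_space UNIV)"
  proof (rule nn_integral_mono)
    fix k
    have eq: "g k x powr p = \<kappa> powr p * 2 powr n * rad k powr (- n) * enn2real (grad_pow v k x)" for x
    proof -
      have "rad (k + 1) powr (- n) = 2 powr n * rad k powr (- n)"
        by (simp add: powr_powr powr_add[symmetric] algebra_simps)
      then show ?thesis unfolding g_def using \<kappa> params by (simp add: powr_mult powr_powr)
    qed
    have "(\<integral>\<^sup>+ x. ennreal (g k x powr p) \<partial>M) \<le>
        (\<integral>\<^sup>+ x. ennreal (\<kappa> powr p * 2 powr n) * (ennreal (rad k powr (- n)) * grad_pow v k x) \<partial>M)"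
    proof (rule nn_integral_mono)
      fix x
      have "ennreal (g k x powr p) = ennreal (\<kappa> powr p * 2 powr n) *
          (ennreal (rad k powr (- n)) * ennreal (enn2real (grad_pow v k x)))"
        unfolding eq by (simp add: ennreal_mult mult.assoc)
      also have "\<dots> \<le> ennreal (\<kappa> powr p * 2 powr n) * (ennreal (rad k powr (- n)) * grad_pow v k x)"
        by (intro mult_left_mono) (auto simp: ennreal_enn2real_if)
      finally show "ennreal (g k x powr p) \<le> \<dots>" .
    qed
    also have "\<dots> = ennreal (\<kappa> powr p * 2 powr n) * (ennreal (rad k powr (- n)) * (\<integral>\<^sup>+ x. grad_pow v k x \<partial>M))"
      by (simp add: nn_integral_cmult)
    finally show "(\<integral>\<^sup>+ x. ennreal (g k x powr p) \<partial>M) \<le> \<dots>" .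
  qed
  also have "\<dots> = ennreal (\<kappa> powr p * 2 powr n) * T"
    unfolding T_def by (rule nn_integral_cmult) simp
  also have "\<dots> \<le> ennreal (\<kappa> powr p * 2 powr n) *
      (ennreal ((2 powr n / (1 - 2 powr (- n / 2))) * (c * D\<^sup>2 * ((D * R)\<^sup>2 / (1 - q\<^sup>2)))) * energy v)"
    by (intro mult_left_mono T) simp
  also have "\<dots> = ennreal hajlasz_const * energy v"
  proof -
    have "ennreal (\<kappa> powr p * 2 powr n) *
        ennreal ((2 powr n / (1 - 2 powr (- n / 2))) * (c * D\<^sup>2 * ((D * R)\<^sup>2 / (1 - q\<^sup>2)))) =
      ennreal ((\<kappa> powr p * 2 powr n) *
        ((2 powr n / (1 - 2 powr (- n / 2))) * (c * D\<^sup>2 * ((D * R)\<^sup>2 / (1 - q\<^sup>2)))))"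
      using q2 t1 params by (intro ennreal_mult[symmetric]) (auto intro!: mult_nonneg_nonneg divide_nonneg_nonneg)
    then show ?thesis unfolding hajlasz_const_def by (simp only: mult.assoc[symmetric])
  qed
  finally show ?thesis .
qed

text \<open>Finite energy replaces the Lebesgue differentiation theorem: where the inner integral
  has a finite value i, the p-th mean deviation from \<open>v x\<close> over the ball at scale k is
  at most \<open>bm k x * i\<close>, and this tends to 0 by decay from the good scale
  \<open>k0\<close>.\<close>

lemma repr_AE_eq:
  assumes [measurable]: "v \<in> borel_measurable borel" and fin: "energy v < \<infinity>" and "good k0"
  shows "AE x in S. repr v x = v x"
proof -
  let ?I = "\<lambda>x. \<integral>\<^sup>+ z. ennreal (\<bar>v x - v z\<bar> powr p / (measure S (ball x (dist x z)))\<^sup>2) \<partial>S"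
  have "AE x in S. ?I x \<noteq> \<infinity>"
    using fin unfolding energy_def by (intro nn_integral_PInf_AE) auto
  then show ?thesis
  proof (rule AE_mp, intro AE_I2 impI)
    fix x assume I: "?I x \<noteq> \<infinity>"
    define i where "i = enn2real (?I x)"
    have i: "?I x = ennreal i" "0 \<le> i" using I unfolding i_def by (auto simp: less_top)
    have close: "\<bar>mean v k x - v x\<bar> \<le> 2 * l" if "0 < l" "bm k x * i \<le> l powr p" for k l
    proof (rule mean_close[OF assms(1) \<open>0 < l\<close>])
      have "(\<integral>\<^sup>+ z. near k x z * ennreal (\<bar>v z - v x\<bar> powr p) \<partial>S) \<le>
          (\<integral>\<^sup>+ z. ennreal ((bm k x)\<^sup>2) * ennreal (\<bar>v x - v z\<bar> powr p / (measure S (ball x (dist x z)))\<^sup>2) \<partial>S)"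
      proof (rule nn_integral_mono)
        fix z
        show "near k x z * ennreal (\<bar>v z - v x\<bar> powr p) \<le>
          ennreal ((bm k x)\<^sup>2) * ennreal (\<bar>v x - v z\<bar> powr p / (measure S (ball x (dist x z)))\<^sup>2)"
        proof (cases "dist x z < rad k \<and> x \<noteq> z")
          case False then show ?thesis using near_cases[of k x z] by auto
        next
          case True
          let ?s = "measure S (ball x (dist x z))"
          have s: "0 < ?s" using True by (intro S_pos) simp
          have "?s \<le> bm k x" unfolding bm_def using True by (intro measure_ball_mono) auto
          then have "?s\<^sup>2 \<le> (bm k x)\<^sup>2" using s by (intro power_mono) auto
          then have "\<bar>v x - v z\<bar> powr p * ?s\<^sup>2 \<le> \<bar>v x - v z\<bar> powr p * (bm k x)\<^sup>2"
            by (intro mult_left_mono) auto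
          then have "\<bar>v x - v z\<bar> powr p \<le> (bm k x)\<^sup>2 * (\<bar>v x - v z\<bar> powr p / ?s\<^sup>2)"
            using s by (simp add: field_simps)
          then show ?thesis using True near_cases[of k x z]
            by (auto simp: ennreal_mult[symmetric] abs_minus_commute intro!: ennreal_leI)
        qed
      qed
      also have "\<dots> = ennreal ((bm k x)\<^sup>2) * ?I x" by (rule nn_integral_cmult) measurable
      also have "\<dots> = ennreal (bm k x * (bm k x * i))"
        unfolding i using i(2) by (simp add: ennreal_mult[symmetric] power2_eq_square mult_ac)
      also have "\<dots> \<le> ennreal (bm k x * l powr p)"
        using that bm_pos[of k x] by (intro ennreal_leI mult_left_mono) auto
      finally show "(\<integral>\<^sup>+ z. near k x z * ennreal (\<bar>v z - v x\<bar> powr p) \<partial>S) \<le> ennreal (bm k x * l powr p)" .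
    qed
    have "(\<lambda>j. mean v (k0 + int j) x) \<longlonglongrightarrow> v x"
    proof (rule LIMSEQ_I)
      fix r :: real assume r: "0 < r"
      have "(\<lambda>j. R * q ^ j * bm k0 x * i) \<longlonglongrightarrow> R * 0 * bm k0 x * i"
        using params by (intro tendsto_intros LIMSEQ_power_zero) auto
      moreover have "0 < (r / 3) powr p" using r by simp
      ultimately have "\<forall>\<^sub>F j in sequentially. R * q ^ j * bm k0 x * i < (r / 3) powr p"
        by (intro order_tendstoD(2)) auto
      then obtain j0 where j0: "\<And>j. j0 \<le> j \<Longrightarrow> R * q ^ j * bm k0 x * i < (r / 3) powr p"
        unfolding eventually_sequentially by blast
      have "norm (mean v (k0 + int j) x - v x) < r" if "j0 \<le> j" for j
      proof -
        have "bm (k0 + int j) x * i \<le> R * q ^ j * bm k0 x * i"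
          using bm_decay[OF assms(3)] i(2) by (intro mult_right_mono) auto
        then have "\<bar>mean v (k0 + int j) x - v x\<bar> \<le> 2 * (r / 3)"
          using j0[OF that] r by (intro close) auto
        then show ?thesis using r by simp
      qed
      then show "\<exists>no. \<forall>j\<ge>no. norm (mean v (k0 + int j) x - v x) < r" by blast
    qed
    then show "repr v x = v x" unfolding repr_def by (rule limI[OF LIMSEQ_int_shift])
  qed
qed

end

section \<open>Besov and Hajlasz--Besov energies on Ahlfors regular spaces\<close>

lemma metric_measure_spaceD:
  assumes "metric_measure_space M"
  shows "sets M = sets borel" "space M = UNIV" "emeasure M (ball x r) < \<infinity>"
    "0 < r \<Longrightarrow> 0 < measure M (ball x r)"
proof -
  show s: "sets M = sets borel" using assms unfolding metric_measure_space_def by blast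
  show "space M = UNIV" using sets_eq_imp_space_eq[OF s] by simp
  show fin: "emeasure M (ball x r) < \<infinity>"
  proof (cases "0 < r")
    case True then show ?thesis using assms unfolding metric_measure_space_def by blast
  next
    case False then have "ball x r = {}" by simp
    then show ?thesis by (simp only: emeasure_empty) simp
  qed
  assume "0 < r"
  then have "0 < emeasure M (ball x r)" using assms unfolding metric_measure_space_def by blast
  then show "0 < measure M (ball x r)" using fin
    by (simp add: emeasure_eq_ennreal_measure less_top)
qed

lemma ahlfors_measure_bounds:
  fixes M :: "'a::metric_space measure"
  assumes "metric_measure_space M" "ahlfors_regular M n" "0 < n" "a0 \<noteq> (b0::'a)"
  obtains C where "1 \<le> C"
    "\<And>x r. 0 < r \<Longrightarrow> emeasure M (ball x r) \<le> ennreal (C * r powr n)"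
    "\<And>x r. 0 < r \<Longrightarrow> measure M (ball x r) \<le> C * r powr n"
    "\<And>x r a b. 0 < r \<Longrightarrow> r \<le> dist a (b::'a) \<Longrightarrow> r powr n / C \<le> measure M (ball x r)"
proof -
  obtain C where C: "1 \<le> C"
    and up: "\<And>x r. 0 < r \<Longrightarrow> emeasure M (ball x r) \<le> ennreal (C * r powr n)"
    and lo: "\<And>x r a b. 0 < r \<Longrightarrow> r \<le> dist a (b::'a) \<Longrightarrow> ennreal (r powr n / C) \<le> emeasure M (ball x r)"
    using ahlfors_bounds[OF assms(2-4)] by metis
  have e: "emeasure M (ball x r) = ennreal (measure M (ball x r))" for x r
    using metric_measure_spaceD(3)[OF assms(1), of x r] by (simp add: emeasure_eq_ennreal_measure less_top)
  show ?thesis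
  proof (rule that[OF C up])
    show "measure M (ball x r) \<le> C * r powr n" if "0 < r" for x r
      using up[OF that, of x] C unfolding e by (subst (asm) ennreal_le_iff) auto
    show "r powr n / C \<le> measure M (ball x r)" if "0 < r" "r \<le> dist a b" for x r and a b :: 'a
      using lo[OF that, of x] unfolding e by (subst (asm) ennreal_le_iff) auto
  qed
qed

text \<open>On the shell containing \<open>dist x y\<close> the power of the distance cancels
  against the gradient inequality, and lower regularity turns \<open>1 / Vball\<close> into
  \<open>rad k powr (- n)\<close>. Integrating over a ball of radius \<open>rad k\<close> cancels
  this in turn by upper regularity.\<close>

lemma besov_le_hajlasz:
  fixes M :: "'a::metric_space measure"
  assumes mm: "metric_measure_space M" and reg: "ahlfors_regular M n" "0 < n" and ne: "a0 \<noteq> (b0::'a)"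
    and p: "1 \<le> p"
  shows "\<exists>C>0. \<forall>u. besov_pow M s p u \<le> ennreal C * hajlasz_besov_pow M s p u"
proof -
  note [measurable_cong] = metric_measure_spaceD(1)[OF mm]
  obtain D :: "'a set" where "countable D" "closure D = UNIV"
    using ahlfors_separable[OF metric_measure_spaceD(1)[OF mm] reg ne] by blast
  note dist_meas = borel_measurable_dist_separable[OF this]
  have [measurable]: "(\<lambda>z. dist (fst z) (snd z)) \<in> borel_measurable (M \<Otimes>\<^sub>M M)"
    using dist_meas by (simp cong: measurable_cong_sets add: metric_measure_spaceD(1)[OF mm] cong: sets_pair_measure_cong)
  interpret M: sigma_finite_measure M
    by (rule sigma_finite_of_balls[OF metric_measure_spaceD(1,3)[OF mm]])
  interpret MM: pair_sigma_finite M M ..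
  obtain C where C: "1 \<le> C"
    and up: "\<And>x r. 0 < r \<Longrightarrow> emeasure M (ball x r) \<le> ennreal (C * r powr n)"
    and lo: "\<And>x r a b. 0 < r \<Longrightarrow> r \<le> dist a (b::'a) \<Longrightarrow> r powr n / C \<le> measure M (ball x r)"
    using ahlfors_measure_bounds[OF mm reg ne] by metis
  let ?rad = "\<lambda>k::int. 2 powr (- real_of_int k) :: real"
  define K where "K = C * 2 powr n * 2 powr p"
  have K: "0 < K" unfolding K_def using C by simp
  have "besov_pow M s p u \<le> ennreal (2 * K * C) *
      (\<integral>\<^sup>+ x. (\<integral>\<^sup>+ k. ennreal (g k x powr p) \<partial>count_space UNIV) \<partial>M)"
    if g: "g \<in> frac_hajlasz_grad M s u" for u g
  proof -
    have [measurable]: "g k \<in> borel_measurable M" and g0: "0 \<le> g k x" for k x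
      using g unfolding frac_hajlasz_grad_def by auto
    obtain E where E: "E \<in> null_sets M" and hg: "\<And>k x y. x \<notin> E \<Longrightarrow> y \<notin> E \<Longrightarrow>
        2 powr (- real_of_int k - 1) \<le> dist x y \<Longrightarrow> dist x y < ?rad k \<Longrightarrow>
        \<bar>u x - u y\<bar> \<le> dist x y powr s * (g k x + g k y)"
      using g unfolding frac_hajlasz_grad_def by blast
    define A where "A k x = ennreal (g k x powr p)" for k x
    have [measurable]: "A k \<in> borel_measurable M" for k unfolding A_def[abs_def] by measurable
    define I where "I k x y = (indicator {..<?rad k} (dist x y) :: ennreal)" for k and x y :: 'a
    have I_meas: "(\<lambda>z. I k (fst z) (snd z)) \<in> borel_measurable (M \<Otimes>\<^sub>M M)" for k
      unfolding I_def by measurable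
    have [measurable]: "(\<lambda>x. I k (h1 x) (h2 x)) \<in> borel_measurable L"
      if "h1 \<in> measurable L M" "h2 \<in> measurable L M" for k h1 h2 and L :: "'c measure"
      using measurable_compose[OF measurable_Pair[OF that] I_meas[of k]] by simp
    have I_ball: "(\<integral>\<^sup>+ y. I k x y \<partial>M) \<le> ennreal (C * ?rad k powr n)" for k x
    proof -
      have "(\<integral>\<^sup>+ y. I k x y \<partial>M) = (\<integral>\<^sup>+ y. indicator (ball x (?rad k)) y \<partial>M)"
        unfolding I_def by (intro nn_integral_cong) (auto simp: indicator_def)
      also have "\<dots> = emeasure M (ball x (?rad k))" by (simp add: metric_measure_spaceD(1)[OF mm])
      also have "\<dots> \<le> ennreal (C * ?rad k powr n)" by (rule up) simp
      finally show ?thesis .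
    qed
    have pt: "ennreal (\<bar>u x - u y\<bar> powr p / (dist x y powr (s * p) * Vball M x y)) \<le>
        (\<integral>\<^sup>+ k. ennreal (K * ?rad k powr (- n)) * (I k x y * (A k x + A k y)) \<partial>count_space UNIV)"
      if "x \<notin> E" "y \<notin> E" for x y
    proof (cases "x = y")
      case True then show ?thesis by simp
    next
      case False
      let ?d = "dist x y"
      have d: "0 < ?d" using False by simp
      then obtain k :: int where k: "2 powr (- real_of_int k - 1) \<le> ?d" "?d < ?rad k"
        by (rule dyadic_scale_exists)
      have V: "?rad k powr n \<le> C * 2 powr n * Vball M x y"
      proof -
        have "?rad k = 2 * 2 powr (- real_of_int k - 1)" by (simp add: powr_diff)
        also have "\<dots> \<le> 2 * ?d" using k(1) by simp
        finally have "?rad k powr n \<le> (2 * ?d) powr n" using reg(2) by (intro powr_mono2) auto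
        also have "\<dots> = 2 powr n * ?d powr n" using d by (simp add: powr_mult)
        also have "?d powr n \<le> C * Vball M x y"
          using lo[OF d order.refl, of x] C unfolding Vball_def by (simp add: field_simps)
        finally show ?thesis by (simp add: mult_ac)
      qed
      have Vpos: "0 < Vball M x y" unfolding Vball_def using metric_measure_spaceD(4)[OF mm d] .
      have "\<bar>u x - u y\<bar> powr p \<le> (?d powr s * (g k x + g k y)) powr p"
        using hg[OF that k] p by (intro powr_mono2) auto
      also have "\<dots> = ?d powr (s * p) * (g k x + g k y) powr p"
        using g0 by (simp add: powr_mult powr_powr)
      also have "\<dots> \<le> ?d powr (s * p) * (2 powr p * (g k x powr p + g k y powr p))"
        using g0 p by (intro mult_left_mono powr_add_le) auto
      finally have "\<bar>u x - u y\<bar> powr p / (?d powr (s * p) * Vball M x y) \<le>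
          ?d powr (s * p) * (2 powr p * (g k x powr p + g k y powr p)) / (?d powr (s * p) * Vball M x y)"
        using Vpos by (intro divide_right_mono) auto
      also have "\<dots> = (2 powr p * (g k x powr p + g k y powr p)) * (1 / Vball M x y)"
        using d by simp
      also have "\<dots> \<le> (2 powr p * (g k x powr p + g k y powr p)) * (C * 2 powr n * ?rad k powr (- n))"
      proof (rule mult_left_mono)
        have "1 \<le> C * 2 powr n * Vball M x y / ?rad k powr n" using V by (subst le_divide_eq) auto
        then show "1 / Vball M x y \<le> C * 2 powr n * ?rad k powr (- n)"
          unfolding powr_minus_divide using Vpos by (simp add: pos_divide_le_eq mult_ac)
      qed simp
      also have "\<dots> = K * ?rad k powr (- n) * (g k x powr p + g k y powr p)"
        unfolding K_def by (simp only: mult_ac)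
      finally have "ennreal (\<bar>u x - u y\<bar> powr p / (?d powr (s * p) * Vball M x y)) \<le>
          ennreal (K * ?rad k powr (- n) * (g k x powr p + g k y powr p))" by (rule ennreal_leI)
      also have "\<dots> = ennreal (K * ?rad k powr (- n)) * (I k x y * (A k x + A k y))"
        using k(2) K unfolding I_def A_def by (simp add: ennreal_mult)
      also have "\<dots> \<le> (\<integral>\<^sup>+ k. ennreal (K * ?rad k powr (- n)) * (I k x y * (A k x + A k y)) \<partial>count_space UNIV)"
        by (rule nn_integral_ge_point) simp
      finally show ?thesis .
    qed
    have AEE: "AE x in M. x \<notin> E" using E by (rule AE_not_in)
    have "besov_pow M s p u \<le>
        (\<integral>\<^sup>+ x. (\<integral>\<^sup>+ y. (\<integral>\<^sup>+ k. ennreal (K * ?rad k powr (- n)) * (I k x y * (A k x + A k y)) \<partial>count_space UNIV) \<partial>M) \<partial>M)"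
      unfolding besov_pow_def
      by (intro nn_integral_mono_AE eventually_mono[OF AEE] impI) (use AEE pt in \<open>auto elim!: eventually_mono intro!: nn_integral_mono_AE\<close>)
    also have "\<dots> = (\<integral>\<^sup>+ x. (\<integral>\<^sup>+ k. (\<integral>\<^sup>+ y. ennreal (K * ?rad k powr (- n)) * (I k x y * (A k x + A k y)) \<partial>M) \<partial>count_space UNIV) \<partial>M)"
      by (intro nn_integral_cong nn_integral_int_swap) measurable
    also have "\<dots> = (\<integral>\<^sup>+ k. (\<integral>\<^sup>+ x. (\<integral>\<^sup>+ y. ennreal (K * ?rad k powr (- n)) * (I k x y * (A k x + A k y)) \<partial>M) \<partial>M) \<partial>count_space UNIV)"
      by (rule nn_integral_int_swap) measurable
    also have "\<dots> \<le> (\<integral>\<^sup>+ k. ennreal (2 * K * C) * (\<integral>\<^sup>+ x. A k x \<partial>M) \<partial>count_space UNIV)"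
    proof (rule nn_integral_mono)
      fix k
      let ?w = "ennreal (K * ?rad k powr (- n))"
      have first: "(\<integral>\<^sup>+ x. (\<integral>\<^sup>+ y. I k x y * A k x \<partial>M) \<partial>M) \<le> ennreal (C * ?rad k powr n) * (\<integral>\<^sup>+ x. A k x \<partial>M)"
      proof -
        have "(\<integral>\<^sup>+ x. (\<integral>\<^sup>+ y. I k x y * A k x \<partial>M) \<partial>M) = (\<integral>\<^sup>+ x. (\<integral>\<^sup>+ y. I k x y \<partial>M) * A k x \<partial>M)"
          by (intro nn_integral_cong nn_integral_multc) measurable
        also have "\<dots> \<le> (\<integral>\<^sup>+ x. ennreal (C * ?rad k powr n) * A k x \<partial>M)"
          by (intro nn_integral_mono mult_right_mono I_ball) simp
        finally show ?thesis by (simp add: nn_integral_cmult)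
      qed
      \<comment> \<open>The term in y reduces to the term in x by Tonelli and the symmetry of
        \<open>I\<close>.\<close>
      have "(\<integral>\<^sup>+ x. (\<integral>\<^sup>+ y. I k x y * A k y \<partial>M) \<partial>M) = (\<integral>\<^sup>+ y. (\<integral>\<^sup>+ x. I k x y * A k y \<partial>M) \<partial>M)"
        by (rule MM.Fubini'[symmetric]) measurable
      also have "\<dots> = (\<integral>\<^sup>+ x. (\<integral>\<^sup>+ y. I k x y * A k x \<partial>M) \<partial>M)"
        unfolding I_def by (simp only: dist_commute)
      finally have second: "(\<integral>\<^sup>+ x. (\<integral>\<^sup>+ y. I k x y * A k y \<partial>M) \<partial>M) = (\<integral>\<^sup>+ x. (\<integral>\<^sup>+ y. I k x y * A k x \<partial>M) \<partial>M)" .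
      have "(\<integral>\<^sup>+ x. (\<integral>\<^sup>+ y. ?w * (I k x y * (A k x + A k y)) \<partial>M) \<partial>M) =
          (\<integral>\<^sup>+ x. ?w * ((\<integral>\<^sup>+ y. I k x y * A k x \<partial>M) + (\<integral>\<^sup>+ y. I k x y * A k y \<partial>M)) \<partial>M)"
        by (intro nn_integral_cong) (simp add: nn_integral_cmult nn_integral_add distrib_left)
      also have "\<dots> = ?w * ((\<integral>\<^sup>+ x. (\<integral>\<^sup>+ y. I k x y * A k x \<partial>M) \<partial>M) + (\<integral>\<^sup>+ x. (\<integral>\<^sup>+ y. I k x y * A k y \<partial>M) \<partial>M))"
        by (simp add: nn_integral_cmult nn_integral_add)
      also have "\<dots> \<le> ?w * (ennreal (C * ?rad k powr n) * (\<integral>\<^sup>+ x. A k x \<partial>M) + ennreal (C * ?rad k powr n) * (\<integral>\<^sup>+ x. A k x \<partial>M))"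
        unfolding second by (intro mult_left_mono add_mono first) simp
      also have "\<dots> = ?w * ennreal (2 * (C * ?rad k powr n)) * (\<integral>\<^sup>+ x. A k x \<partial>M)"
      proof -
        have "ennreal (2 * (C * ?rad k powr n)) = ennreal (C * ?rad k powr n) + ennreal (C * ?rad k powr n)"
          using C by (subst ennreal_plus[symmetric]) auto
        then show ?thesis by (simp only: mult.assoc distrib_right)
      qed
      also have "?w * ennreal (2 * (C * ?rad k powr n)) = ennreal (K * ?rad k powr (- n) * (2 * (C * ?rad k powr n)))"
        using C K by (intro ennreal_mult[symmetric]) auto
      also have "K * ?rad k powr (- n) * (2 * (C * ?rad k powr n)) = 2 * K * C"
        by (simp add: powr_minus)
      finally show "(\<integral>\<^sup>+ x. (\<integral>\<^sup>+ y. ?w * (I k x y * (A k x + A k y)) \<partial>M) \<partial>M) \<le> ennreal (2 * K * C) * (\<integral>\<^sup>+ x. A k x \<partial>M)" .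
    qed
    also have "\<dots> = ennreal (2 * K * C) * (\<integral>\<^sup>+ k. (\<integral>\<^sup>+ x. A k x \<partial>M) \<partial>count_space UNIV)"
      by (rule nn_integral_cmult) simp
    also have "(\<integral>\<^sup>+ k. (\<integral>\<^sup>+ x. A k x \<partial>M) \<partial>count_space UNIV) = (\<integral>\<^sup>+ x. (\<integral>\<^sup>+ k. A k x \<partial>count_space UNIV) \<partial>M)"
      by (rule nn_integral_int_swap[symmetric]) measurable
    finally show ?thesis unfolding A_def .
  qed
  note bound = this
  define B where "B = 2 * K * C"
  have B: "0 < B" unfolding B_def using K C by simp
  have inv: "ennreal B * ennreal (1 / B) = 1" using B by (simp add: ennreal_mult[symmetric])
  have "besov_pow M s p u \<le> ennreal B * hajlasz_besov_pow M s p u" for u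
  proof -
    \<comment> \<open>Dividing first leaves the infimum without a factor, so it can be bounded
      gradient by gradient.\<close>
    have "ennreal (1 / B) * besov_pow M s p u \<le> hajlasz_besov_pow M s p u"
      unfolding hajlasz_besov_pow_def
    proof (rule INF_greatest)
      fix g assume "g \<in> frac_hajlasz_grad M s u"
      from mult_left_mono[OF bound[OF this], of "ennreal (1 / B)"] inv
      show "ennreal (1 / B) * besov_pow M s p u \<le> (\<integral>\<^sup>+ x. (\<integral>\<^sup>+ k. ennreal (g k x powr p) \<partial>count_space UNIV) \<partial>M)"
        unfolding B_def[symmetric] by (simp add: mult.assoc[symmetric] mult.commute[of "ennreal (1 / B)"])
    qed
    from mult_left_mono[OF this, of "ennreal B"] inv
    show ?thesis by (simp add: mult.assoc[symmetric])
  qed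
  then show ?thesis using B by blast
qed

text \<open>One point x with a finite inner integral suffices: on a bounded set the denominator of
  the kernel is bounded, so the kernel controls the p-th power of \<open>u x - u y\<close>, and
  \<open>u x\<close> is a constant.\<close>

lemma Lp_loc_of_besov_finite:
  fixes M :: "'a::metric_space measure"
  assumes mm: "metric_measure_space M" and [measurable]: "u \<in> borel_measurable M"
    and fin: "besov_pow M s p u < \<infinity>" and "0 \<le> s" "1 \<le> p"
  shows "Lp_loc M p u"
proof -
  note sets_M[measurable_cong] = metric_measure_spaceD(1)[OF mm]
  define J where "J x y = ennreal (\<bar>u x - u y\<bar> powr p / (dist x y powr (s * p) * Vball M x y))" for x y
  \<comment> \<open>With x fixed, the ball mass is a monotone function of its radius, hence
    Borel.\<close>
  have J_meas[measurable]: "J x \<in> borel_measurable M" for x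
  proof -
    have "mono (\<lambda>t. measure M (ball x t))"
      using metric_measure_spaceD(3)[OF mm]
      by (intro monoI measure_mono_fmeasurable) (auto simp: sets_M fmeasurable_def)
    then have [measurable]: "(\<lambda>t. measure M (ball x t)) \<in> borel_measurable borel"
      by (rule borel_measurable_mono)
    have [measurable]: "(\<lambda>y. dist x y) \<in> borel_measurable borel"
      by (intro borel_measurable_continuous_onI continuous_intros)
    show ?thesis unfolding J_def[abs_def] Vball_def by measurable
  qed
  obtain x where x: "(\<integral>\<^sup>+ y. J x y \<partial>M) < \<infinity>"
  proof (rule ccontr)
    assume "\<not> thesis"
    then have "\<not> (\<integral>\<^sup>+ y. J x y \<partial>M) < \<infinity>" for x using that by blast
    then have "(\<integral>\<^sup>+ y. J x y \<partial>M) = \<infinity>" for x using top.not_eq_extremum by (metis infinity_ennreal_def)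
    then have "besov_pow M s p u = (\<integral>\<^sup>+ x. \<infinity> \<partial>M)" unfolding besov_pow_def J_def by simp
    also have "\<dots> = \<infinity> * emeasure M UNIV" by (simp add: metric_measure_spaceD(2)[OF mm])
    also have "\<dots> = \<infinity>"
    proof -
      let ?z = "undefined :: 'a"
      have "0 < measure M (ball ?z 1)" by (rule metric_measure_spaceD(4)[OF mm]) simp
      then have "emeasure M (ball ?z 1) \<noteq> 0" by (auto simp: Sigma_Algebra.measure_def)
      moreover have "emeasure M (ball ?z 1) \<le> emeasure M UNIV" by (intro emeasure_mono) (auto simp: sets_M)
      ultimately have "emeasure M UNIV \<noteq> 0" by auto
      then show ?thesis by (simp add: ennreal_top_mult)
    qed
    finally show False using fin by simp
  qed
  show ?thesis unfolding Lp_loc_def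
  proof (intro conjI allI)
    fix z r
    define T where "T = dist x z + \<bar>r\<bar> + 1"
    have T: "0 < T" unfolding T_def by (simp add: add_nonneg_pos)
    define K where "K = T powr (s * p) * measure M (ball x T)"
    have "indicator (ball z r) y * ennreal (\<bar>u y\<bar> powr p) \<le>
        indicator (ball z r) y * ennreal (2 powr p * \<bar>u x\<bar> powr p) + ennreal (2 powr p * K) * J x y" for y
    proof (cases "y \<in> ball z r")
      case False then show ?thesis by simp
    next
      case True
      then have dT: "dist x y \<le> T" using dist_triangle[of x y z] unfolding T_def by simp
      have *: "ennreal (\<bar>u x - u y\<bar> powr p) \<le> ennreal K * J x y"
      proof (cases "x = y")
        case False
        let ?v = "Vball M x y"
        have v: "0 < ?v" unfolding Vball_def using False by (intro metric_measure_spaceD(4)[OF mm]) simp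
        have "dist x y powr (s * p) \<le> T powr (s * p)" using dT assms(4,5) by (intro powr_mono2) auto
        moreover have "?v \<le> measure M (ball x T)"
          unfolding Vball_def using metric_measure_spaceD(3)[OF mm] dT
          by (intro measure_mono_fmeasurable) (auto simp: sets_M fmeasurable_def)
        ultimately have "dist x y powr (s * p) * ?v \<le> K" unfolding K_def using v by (intro mult_mono) auto
        then have "\<bar>u x - u y\<bar> powr p * (dist x y powr (s * p) * ?v) \<le> \<bar>u x - u y\<bar> powr p * K"
          by (rule mult_left_mono) simp
        then have "\<bar>u x - u y\<bar> powr p \<le> K * (\<bar>u x - u y\<bar> powr p / (dist x y powr (s * p) * ?v))"
          using v False by (simp add: field_simps)
        then show ?thesis unfolding J_def
          by (subst ennreal_mult'[symmetric]) (auto simp: K_def intro: ennreal_leI)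
      qed simp
      have "\<bar>u y\<bar> powr p \<le> (\<bar>u x\<bar> + \<bar>u x - u y\<bar>) powr p" using assms(5) by (intro powr_mono2) auto
      also have "\<dots> \<le> 2 powr p * (\<bar>u x\<bar> powr p + \<bar>u x - u y\<bar> powr p)"
        using assms(5) by (intro powr_add_le) auto
      finally have "ennreal (\<bar>u y\<bar> powr p) \<le> ennreal (2 powr p * \<bar>u x\<bar> powr p + 2 powr p * \<bar>u x - u y\<bar> powr p)"
        by (intro ennreal_leI) (simp add: distrib_left)
      also have "\<dots> = ennreal (2 powr p * \<bar>u x\<bar> powr p) + ennreal (2 powr p) * ennreal (\<bar>u x - u y\<bar> powr p)"
        by (simp add: ennreal_mult)
      also have "\<dots> \<le> ennreal (2 powr p * \<bar>u x\<bar> powr p) + ennreal (2 powr p) * (ennreal K * J x y)"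
        by (intro add_left_mono mult_left_mono *) simp
      also have "\<dots> = ennreal (2 powr p * \<bar>u x\<bar> powr p) + ennreal (2 powr p * K) * J x y"
        by (simp add: ennreal_mult' mult.assoc)
      finally show ?thesis using True by simp
    qed
    then have "(\<integral>\<^sup>+ y. indicator (ball z r) y * ennreal (\<bar>u y\<bar> powr p) \<partial>M) \<le>
        (\<integral>\<^sup>+ y. indicator (ball z r) y * ennreal (2 powr p * \<bar>u x\<bar> powr p) + ennreal (2 powr p * K) * J x y \<partial>M)"
      by (rule nn_integral_mono)
    also have "\<dots> = emeasure M (ball z r) * ennreal (2 powr p * \<bar>u x\<bar> powr p) + ennreal (2 powr p * K) * (\<integral>\<^sup>+ y. J x y \<partial>M)"
    proof -
      have [measurable]: "ball z r \<in> sets M" by (simp add: sets_M)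
      show ?thesis by (simp add: nn_integral_add nn_integral_multc nn_integral_cmult)
    qed
    also have "\<dots> < \<infinity>"
      using metric_measure_spaceD(3)[OF mm, of z r] x
      by (auto simp: ennreal_mult_less_top)
    finally show "(\<integral>\<^sup>+ y. indicator (ball z r) y * ennreal (\<bar>u y\<bar> powr p) \<partial>M) < \<infinity>" .
  qed simp
qed

section \<open>Quasisymmetric maps\<close>

text \<open>A form of quasisymmetry without gauge function that visibly passes to the inverse map.\<close>

definition weakly_quasisymmetric :: "('a::metric_space \<Rightarrow> 'b::metric_space) \<Rightarrow> bool" where
  "weakly_quasisymmetric f \<longleftrightarrow>
     (\<forall>\<Lambda>. \<exists>H>0. \<forall>x a b. dist x a \<le> \<Lambda> * dist x b \<longrightarrow> dist (f x) (f a) \<le> H * dist (f x) (f b)) \<and>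
     (\<forall>\<epsilon>>0. \<exists>\<delta>>0. \<forall>x a b. dist x a \<le> \<delta> * dist x b \<longrightarrow> dist (f x) (f a) \<le> \<epsilon> * dist (f x) (f b))"

text \<open>An injective continuous function on an interval is strictly monotone; a zero at a
  positive t would force a negative value on one side of t.\<close>

lemma homeomorphism_half_line_0:
  fixes \<eta> :: "real \<Rightarrow> real"
  assumes "homeomorphism {0..} {0..} \<eta> \<eta>'"
  shows "\<eta> 0 = 0"
proof (rule ccontr)
  assume ne: "\<eta> 0 \<noteq> 0"
  define t where "t = \<eta>' 0"
  have im: "\<eta> ` {0..} = {0..}" "\<eta>' ` {0..} = {0..}" and inv: "\<And>x. 0 \<le> x \<Longrightarrow> \<eta>' (\<eta> x) = x"
    "\<And>y. 0 \<le> y \<Longrightarrow> \<eta> (\<eta>' y) = y" and cont: "continuous_on {0..} \<eta>"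
    using assms unfolding homeomorphism_def by auto
  have t: "\<eta> t = 0" "0 \<le> t" unfolding t_def using inv(2)[of 0] im(2) by auto
  then have "0 < t" using ne by (cases "t = 0") auto
  moreover have "inj_on \<eta> {0..t + 1}" by (rule inj_on_inverseI[of _ \<eta>']) (simp add: inv)
  moreover have "continuous_on {0..t + 1} \<eta>" by (rule continuous_on_subset[OF cont]) auto
  ultimately have "\<eta> 0 < \<eta> t \<and> \<eta> t < \<eta> (t + 1) \<or> \<eta> (t + 1) < \<eta> t \<and> \<eta> t < \<eta> 0"
    using continuous_inj_imp_mono[of 0 t "t + 1" \<eta>] by simp
  moreover have "0 \<le> \<eta> 0" "0 \<le> \<eta> (t + 1)" using im(1) t(2) by auto
  ultimately show False using t(1) by simp
qed

text \<open>The first clause is boundedness of the gauge on the compact interval from 0 to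
  \<Lambda>, the second its continuity at 0 together with its value 0 there.\<close>

lemma quasisymmetric_imp_weakly:
  assumes "quasisymmetric f"
  shows "weakly_quasisymmetric f"
proof -
  obtain \<eta> \<eta>' where \<eta>: "homeomorphism {0::real..} {0..} \<eta> \<eta>'"
    and qs: "\<And>a b x. x \<noteq> b \<Longrightarrow> dist (f x) (f a) / dist (f x) (f b) \<le> \<eta> (dist x a / dist x b)"
    using assms unfolding quasisymmetric_def by blast
  have inj: "f x = f y \<longleftrightarrow> x = y" for x y
    using assms unfolding quasisymmetric_def homeomorphism_def by (metis UNIV_I)
  have cont: "continuous_on {0..} \<eta>" using \<eta> unfolding homeomorphism_def by blast
  have transfer: "dist (f x) (f a) \<le> H * dist (f x) (f b)"
    if "dist x a \<le> \<Lambda> * dist x b" "\<And>t. 0 \<le> t \<Longrightarrow> t \<le> \<Lambda> \<Longrightarrow> \<eta> t \<le> H" for x a b H \<Lambda>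
  proof (cases "x = b")
    case True then show ?thesis using that(1) by simp
  next
    case False
    then have "0 < dist x b" "0 < dist (f x) (f b)" using inj by auto
    moreover have "\<eta> (dist x a / dist x b) \<le> H"
      using that(1) \<open>0 < dist x b\<close> by (intro that(2)) (auto simp: field_simps)
    moreover have "dist (f x) (f a) / dist (f x) (f b) \<le> \<eta> (dist x a / dist x b)" by (rule qs[OF False])
    ultimately have "dist (f x) (f a) / dist (f x) (f b) \<le> H" "0 < dist (f x) (f b)" by linarith+
    then show ?thesis by (simp only: pos_divide_le_eq)
  qed
  have "\<exists>H>0. \<forall>x a b. dist x a \<le> \<Lambda> * dist x b \<longrightarrow> dist (f x) (f a) \<le> H * dist (f x) (f b)" for \<Lambda>
  proof -
    have "compact (\<eta> ` {0..\<Lambda>})"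
      by (intro compact_continuous_image continuous_on_subset[OF cont]) auto
    then obtain H where "\<And>t. t \<in> {0..\<Lambda>} \<Longrightarrow> \<bar>\<eta> t\<bar> \<le> H"
      using compact_imp_bounded bounded_iff by (metis imageI real_norm_def)
    then have "\<eta> t \<le> max H 1" if "0 \<le> t" "t \<le> \<Lambda>" for t using that by fastforce
    then show ?thesis using transfer[of _ _ \<Lambda> _ "max H 1"] by (intro exI[of _ "max H 1"]) auto
  qed
  moreover have "\<exists>\<delta>>0. \<forall>x a b. dist x a \<le> \<delta> * dist x b \<longrightarrow> dist (f x) (f a) \<le> \<epsilon> * dist (f x) (f b)"
    if "0 < \<epsilon>" for \<epsilon>
  proof -
    obtain d where d: "0 < d" "\<And>t. t \<in> {0..} \<Longrightarrow> dist t 0 < d \<Longrightarrow> dist (\<eta> t) (\<eta> 0) < \<epsilon>"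
      using cont \<open>0 < \<epsilon>\<close> unfolding continuous_on_iff by (metis atLeast_iff order.refl)
    have "\<eta> t \<le> \<epsilon>" if "0 \<le> t" "t \<le> d / 2" for t
      using d(2)[of t] that d(1) homeomorphism_half_line_0[OF \<eta>] by (simp add: dist_real_def)
    then show ?thesis using transfer[of _ _ "d / 2" _ \<epsilon>] d(1) by (intro exI[of _ "d / 2"]) auto
  qed
  ultimately show ?thesis unfolding weakly_quasisymmetric_def by blast
qed

text \<open>Negating the conclusion for \<open>g\<close> yields the hypothesis for \<open>f\<close>
  with a and b exchanged. Each clause for \<open>g\<close> therefore comes from the other clause for
  \<open>f\<close>.\<close>

lemma weakly_quasisymmetric_inverse:
  assumes wqs: "weakly_quasisymmetric f" and fg: "\<And>y. f (g y) = y" and gf: "\<And>x. g (f x) = x"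
  shows "weakly_quasisymmetric g"
proof -
  have inj: "g x = g y \<longleftrightarrow> x = y" for x y using fg by metis
  have "\<exists>H>0. \<forall>x a b. dist x a \<le> \<Lambda> * dist x b \<longrightarrow> dist (g x) (g a) \<le> H * dist (g x) (g b)" for \<Lambda>
  proof -
    \<comment> \<open>The added 1 makes the two resulting inequalities incompatible unless x = b;
      the factor 2 in \<open>1 / (2 * H)\<close> plays this part for the other clause.\<close>
    have "0 < 1 / (\<bar>\<Lambda>\<bar> + 1)" by (simp add: add_nonneg_pos)
    then obtain \<delta> where \<delta>: "0 < \<delta>"
      "\<And>x a b. dist x a \<le> \<delta> * dist x b \<Longrightarrow> dist (f x) (f a) \<le> 1 / (\<bar>\<Lambda>\<bar> + 1) * dist (f x) (f b)"
      using wqs unfolding weakly_quasisymmetric_def by meson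
    have "dist (g x) (g a) \<le> 1 / \<delta> * dist (g x) (g b)" if le: "dist x a \<le> \<Lambda> * dist x b" for x a b
    proof (rule ccontr)
      assume "\<not> ?thesis"
      then have lt: "dist (g x) (g b) < \<delta> * dist (g x) (g a)" using \<delta>(1) by (simp add: field_simps)
      then have "dist x b \<le> 1 / (\<bar>\<Lambda>\<bar> + 1) * dist x a" using \<delta>(2)[of "g x" "g b" "g a"] fg by simp
      then have "(\<bar>\<Lambda>\<bar> + 1) * dist x b \<le> dist x a" by (simp add: field_simps add_nonneg_pos)
      also have "\<dots> \<le> \<bar>\<Lambda>\<bar> * dist x b" using le by (rule order.trans) (intro mult_right_mono, auto)
      finally have "x = b" by (simp add: distrib_right)
      then have "x = a" using le by simp
      with \<open>x = b\<close> lt show False by simp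
    qed
    then show ?thesis using \<delta>(1) by (intro exI[of _ "1 / \<delta>"]) simp
  qed
  moreover have "\<exists>\<delta>>0. \<forall>x a b. dist x a \<le> \<delta> * dist x b \<longrightarrow> dist (g x) (g a) \<le> \<epsilon> * dist (g x) (g b)"
    if "0 < \<epsilon>" for \<epsilon>
  proof -
    obtain H where H: "0 < H"
      "\<And>x a b. dist x a \<le> 1 / \<epsilon> * dist x b \<Longrightarrow> dist (f x) (f a) \<le> H * dist (f x) (f b)"
      using wqs unfolding weakly_quasisymmetric_def by meson
    have "dist (g x) (g a) \<le> \<epsilon> * dist (g x) (g b)" if le: "dist x a \<le> 1 / (2 * H) * dist x b" for x a b
    proof (rule ccontr)
      assume "\<not> ?thesis"
      then have lt: "\<epsilon> * dist (g x) (g b) < dist (g x) (g a)" by simp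
      then have "dist (g x) (g b) \<le> 1 / \<epsilon> * dist (g x) (g a)" using \<open>0 < \<epsilon>\<close> by (simp add: field_simps)
      then have "dist x b \<le> H * dist x a" using H(2)[of "g x" "g b" "g a"] fg by simp
      also have "\<dots> \<le> H * (1 / (2 * H) * dist x b)" using le H(1) by (intro mult_left_mono) auto
      also have "\<dots> = dist x b / 2" using H(1) by simp
      finally have "x = b" using zero_le_dist[of x b] dist_eq_0_iff[of x b] by linarith
      then have "x = a" using le by simp
      with \<open>x = b\<close> lt show False by simp
    qed
    then show ?thesis using H(1) by (intro exI[of _ "1 / (2 * H)"]) auto
  qed
  ultimately show ?thesis unfolding weakly_quasisymmetric_def by blast
qed

text \<open>The ratio is the m-th root of 1/2. The leading 2 covers an incomplete block: for j below
  m the factor \<open>2 * r ^ j\<close> is still at least 1.\<close>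

lemma halving_imp_geometric:
  fixes b :: "nat \<Rightarrow> real"
  assumes dec: "\<And>i. b (Suc i) \<le> b i" and half: "\<And>i. b (i + m) \<le> b i / 2"
    and "0 < m" and nonneg: "\<And>i. 0 \<le> b i"
  shows "b j \<le> 2 * ((1 / 2) powr (1 / real m)) ^ j * b 0"
proof (induction j rule: less_induct)
  case (less j)
  define r where "r = (1 / 2 :: real) powr (1 / real m)"
  have r: "0 < r" "r \<le> 1" unfolding r_def by (auto intro: powr_le1)
  have rm: "r ^ m = 1 / 2" unfolding r_def using \<open>0 < m\<close> by (simp add: powr_realpow[symmetric] powr_powr)
  show ?case
  proof (cases "j < m")
    case True
    have "b j \<le> b 0" using lift_Suc_antimono_le[of b 0 j] dec by simp
    also have "1 * b 0 \<le> 2 * r ^ j * b 0"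
    proof (rule mult_right_mono)
      have "r ^ m \<le> r ^ j" using True r by (intro power_decreasing) auto
      then show "1 \<le> 2 * r ^ j" using rm by simp
    qed (rule nonneg)
    finally show ?thesis unfolding r_def by simp
  next
    case False
    then obtain i where i: "j = i + m" by (metis add.commute le_add_diff_inverse not_less)
    have "b j \<le> b i / 2" unfolding i by (rule half)
    also have "\<dots> \<le> (2 * r ^ i * b 0) / 2"
      using less.IH[of i] \<open>0 < m\<close> i unfolding r_def by (intro divide_right_mono) auto
    also have "\<dots> = 2 * r ^ j * b 0" unfolding i power_add rm by simp
    finally show ?thesis unfolding r_def .
  qed
qed

section \<open>The pulled-back measure: comparison with image distances, doubling and decay\<close>

locale quasisymmetric_pullback =
  fixes N :: "'b::metric_space measure" and f :: "'a::metric_space \<Rightarrow> 'b" and g and n :: real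
    and C :: real and a0 b0 :: 'a
  assumes mm: "metric_measure_space N" and wqs: "weakly_quasisymmetric f"
    and hom: "homeomorphism UNIV UNIV f g" and n: "0 < n" and ne: "a0 \<noteq> b0"
    and C: "1 \<le> C" and upper: "\<And>y r. 0 < r \<Longrightarrow> measure N (ball y r) \<le> C * r powr n"
    and lower: "\<And>y r a b. 0 < r \<Longrightarrow> r \<le> dist a (b::'b) \<Longrightarrow> r powr n / C \<le> measure N (ball y r)"
begin

definition pullback :: "'a measure" where "pullback = distr N borel g"

lemma fg [simp]: "f (g y) = y" and gf [simp]: "g (f x) = x"
  using hom unfolding homeomorphism_def by auto

lemma f_eq_iff [simp]: "f x = f y \<longleftrightarrow> x = y"
  by (metis gf)

lemma g_measurable: "g \<in> measurable N borel"
proof -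
  have "g \<in> measurable borel borel"
    using hom by (intro borel_measurable_continuous_onI) (simp add: homeomorphism_def)
  then show ?thesis using measurable_cong_sets[OF metric_measure_spaceD(1)[OF mm] refl] by blast
qed

lemma f_measurable: "f \<in> measurable borel borel"
  using hom by (intro borel_measurable_continuous_onI) (simp add: homeomorphism_def)

lemma sets_pullback: "sets pullback = sets borel"
  unfolding pullback_def by simp

lemma emeasure_pullback_ball: "emeasure pullback (ball x r) = emeasure N (g -` ball x r)"
  unfolding pullback_def using g_measurable
  by (subst emeasure_distr) (auto simp: metric_measure_spaceD(2)[OF mm])

lemma measure_pullback_ball: "measure pullback (ball x r) = measure N (g -` ball x r)"
  unfolding Sigma_Algebra.measure_def emeasure_pullback_ball ..

lemma sets_preimage: "g -` ball x r \<in> sets N"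
  using measurable_sets[OF g_measurable, of "ball x r"] by (simp add: metric_measure_spaceD(2)[OF mm])

lemma subset_ball_measure: "A \<subseteq> ball y r \<Longrightarrow> measure N A \<le> measure N (ball y r)" if "A \<in> sets N" for A
  using metric_measure_spaceD(1,3)[OF mm] that
  by (intro measure_mono_fmeasurable) (auto simp: fmeasurable_def)

lemma preimage_subset:
  assumes H: "\<And>x a b. dist x a \<le> \<Lambda> * dist x b \<Longrightarrow> dist (f x) (f a) \<le> H * dist (f x) (f b)"
    and "x \<noteq> b" "t \<le> \<Lambda> * dist x b" "0 < H"
  shows "g -` ball x t \<subseteq> ball (f x) (2 * H * dist (f x) (f b))"
proof
  fix y assume "y \<in> g -` ball x t"
  then have "dist x (g y) \<le> \<Lambda> * dist x b" using assms(3) by simp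
  then have "dist (f x) y \<le> H * dist (f x) (f b)" using H[of x "g y" b] by simp
  \<comment> \<open>The factor 2 only buys the strict inequality required by an open ball.\<close>
  also have "\<dots> < 2 * H * dist (f x) (f b)" using assms by simp
  finally show "y \<in> ball (f x) (2 * H * dist (f x) (f b))" by simp
qed

text \<open>The pair (\<Lambda>, H) is left free: large values give doubling, small ones give
  decay.\<close>

lemma pullback_upper:
  assumes "\<And>x a b. dist x a \<le> \<Lambda> * dist x b \<Longrightarrow> dist (f x) (f a) \<le> H * dist (f x) (f b)"
    and "x \<noteq> b" "t \<le> \<Lambda> * dist x b" "0 < H"
  shows "measure pullback (ball x t) \<le> C * (2 * H) powr n * dist (f x) (f b) powr n"
proof -
  have "measure pullback (ball x t) \<le> measure N (ball (f x) (2 * H * dist (f x) (f b)))"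
    unfolding measure_pullback_ball
    by (rule subset_ball_measure[OF sets_preimage preimage_subset[OF assms]])
  also have "\<dots> \<le> C * (2 * H * dist (f x) (f b)) powr n"
    using assms by (intro upper mult_pos_pos) auto
  also have "\<dots> = C * (2 * H) powr n * dist (f x) (f b) powr n"
    using assms by (simp add: powr_mult)
  finally show ?thesis .
qed

lemma pullback_finite: "emeasure pullback (ball x t) < \<infinity>"
proof -
  obtain b where b: "x \<noteq> b" using ne by metis
  define \<Lambda> where "\<Lambda> = t / dist x b"
  obtain H where H: "0 < H" "\<And>x a b. dist x a \<le> \<Lambda> * dist x b \<Longrightarrow> dist (f x) (f a) \<le> H * dist (f x) (f b)"
    using wqs unfolding weakly_quasisymmetric_def by meson
  have "t \<le> \<Lambda> * dist x b" unfolding \<Lambda>_def using b by simp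
  note preimage_subset[OF H(2) b this H(1)]
  then have "emeasure N (g -` ball x t) \<le> emeasure N (ball (f x) (2 * H * dist (f x) (f b)))"
    by (intro emeasure_mono) (auto simp: metric_measure_spaceD(1)[OF mm])
  also have "\<dots> < \<infinity>" by (rule metric_measure_spaceD(3)[OF mm])
  finally show ?thesis unfolding emeasure_pullback_ball .
qed

lemma pullback_pos:
  assumes "0 < r"
  shows "0 < measure pullback (ball x r)"
proof -
  have "open (g -` ball x r)"
    using hom by (intro open_vimage) (auto simp: homeomorphism_def)
  moreover have "f x \<in> g -` ball x r" using assms by simp
  ultimately obtain e where e: "0 < e" "ball (f x) e \<subseteq> g -` ball x r" by (meson open_contains_ball)
  have "0 < measure N (ball (f x) e)" by (rule metric_measure_spaceD(4)[OF mm e(1)])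
  also have "\<dots> \<le> measure N (g -` ball x r)"
    using e(2) sets_preimage pullback_finite[of x r] unfolding emeasure_pullback_ball
    by (intro measure_mono_fmeasurable) (auto simp: fmeasurable_def metric_measure_spaceD(1)[OF mm])
  finally show ?thesis unfolding measure_pullback_ball .
qed

text \<open>By quasisymmetry with ratio 1, points outside the ball have images at distance at least
  \<open>dist (f x) (f b) / H\<close> from \<open>f x\<close>, so the image of the ball contains a
  ball of that radius.\<close>

lemma pullback_lower:
  obtains C1 where "0 < C1"
    "\<And>x b t. x \<noteq> b \<Longrightarrow> dist x b \<le> t \<Longrightarrow> dist (f x) (f b) powr n \<le> C1 * measure pullback (ball x t)"
proof -
  obtain H where H0: "0 < H" and H: "\<And>x a b. dist x a \<le> 1 * dist x b \<Longrightarrow> dist (f x) (f a) \<le> H * dist (f x) (f b)"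
    using wqs unfolding weakly_quasisymmetric_def by meson
  \<comment> \<open>Ensures that the radius divided by \<open>H\<close> is still at most a realised
    distance, as the lower regularity bound requires.\<close>
  have H1: "1 \<le> H" using H[of a0 b0 b0] ne by simp
  show ?thesis
  proof (rule that[of "C * H powr n"])
    show "0 < C * H powr n" using C H0 by simp
    fix x b :: 'a and t assume *: "x \<noteq> b" "dist x b \<le> t"
    let ?\<rho> = "dist (f x) (f b)"
    have \<rho>: "0 < ?\<rho>" using * by simp
    have "ball (f x) (?\<rho> / H) \<subseteq> g -` ball x t"
    proof
      fix y assume y: "y \<in> ball (f x) (?\<rho> / H)"
      show "y \<in> g -` ball x t"
      proof (rule ccontr)
        assume "y \<notin> g -` ball x t"
        then have "dist x b \<le> 1 * dist x (g y)" using *(2) by simp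
        from H[OF this] have "?\<rho> / H \<le> dist (f x) y" using H0 by (simp add: field_simps)
        then show False using y by simp
      qed
    qed
    then have "measure N (ball (f x) (?\<rho> / H)) \<le> measure N (g -` ball x t)"
      using sets_preimage pullback_finite[of x t] unfolding emeasure_pullback_ball
      by (intro measure_mono_fmeasurable) (auto simp: fmeasurable_def metric_measure_spaceD(1)[OF mm])
    moreover have "(?\<rho> / H) powr n / C \<le> measure N (ball (f x) (?\<rho> / H))"
    proof (rule lower[of _ "f x" "f b"])
      have "?\<rho> * 1 \<le> ?\<rho> * H" using H1 \<rho> by (intro mult_left_mono) auto
      then show "?\<rho> / H \<le> ?\<rho>" using H0 by (simp add: field_simps)
    qed (use \<rho> H0 in simp)
    ultimately have "(?\<rho> / H) powr n / C \<le> measure pullback (ball x t)"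
      unfolding measure_pullback_ball by linarith
    then show "?\<rho> powr n \<le> C * H powr n * measure pullback (ball x t)"
      using C H0 by (simp add: powr_divide field_simps)
  qed
qed

text \<open>All ball masses about x are compared with \<open>dist (f x) (f y) powr n\<close> for one
  auxiliary point y: from above by \<open>pullback_upper\<close>, from below by
  \<open>pullback_lower\<close>.\<close>

lemma pullback_doubling_decay:
  assumes perfect: "1 \<le> \<Lambda>"
    "\<forall>(x::'a) r a b. 0 < r \<longrightarrow> r \<le> dist a (b::'a) \<longrightarrow> (\<exists>y. r / \<Lambda> \<le> dist x y \<and> dist x y < r)"
  obtains D q where "1 \<le> D" "0 < q" "q < 1"
    "\<And>k x. \<exists>a b::'a. 2 powr (- real_of_int k - 2) \<le> dist a b \<Longrightarrow>
      measure pullback (ball x (2 powr (- real_of_int (k - 1)))) \<le> D * measure pullback (ball x (2 powr (- real_of_int k)))"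
    "\<And>k x j. \<exists>a b::'a. 2 powr (- real_of_int k - 2) \<le> dist a b \<Longrightarrow>
      measure pullback (ball x (2 powr (- real_of_int (k + int j)))) \<le> 2 * q ^ j * measure pullback (ball x (2 powr (- real_of_int k)))"
proof -
  let ?rad = "\<lambda>k. 2 powr (- real_of_int k) :: real"
  define good where "good k \<longleftrightarrow> (\<exists>a b::'a. 2 powr (- real_of_int k - 2) \<le> dist a b)" for k
  obtain C1 where C1: "0 < C1"
    "\<And>x b t. x \<noteq> b \<Longrightarrow> dist x b \<le> t \<Longrightarrow> dist (f x) (f b) powr n \<le> C1 * measure pullback (ball x t)"
    using pullback_lower by blast
  \<comment> \<open>Quasisymmetry controls distances only relative to a second point. Uniform
    perfectness, used at the quarter radius allowed by \<open>good\<close>, supplies one at distance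
    comparable to the radius.\<close>
  have anchor: "\<exists>y. x \<noteq> y \<and> dist x y \<le> ?rad k \<and> ?rad k \<le> 4 * \<Lambda> * dist x y" if "good k" for k and x :: 'a
  proof -
    let ?r = "2 powr (- real_of_int k - 2) :: real"
    have r: "?rad k = 4 * ?r" by (simp add: powr_diff)
    obtain y where y: "?r / \<Lambda> \<le> dist x y" "dist x y < ?r"
      using perfect(2)[rule_format, of ?r _ _ x] \<open>good k\<close> unfolding good_def by fastforce
    have "?r \<le> \<Lambda> * dist x y" using y(1) perfect(1) by (simp add: field_simps)
    moreover have "0 < ?r" by simp
    moreover from calculation have "x \<noteq> y" by force
    moreover have "dist x y \<le> 4 * ?r" using y(2) \<open>0 < ?r\<close> by linarith
    moreover have "4 * ?r \<le> 4 * \<Lambda> * dist x y" using \<open>?r \<le> \<Lambda> * dist x y\<close> by simp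
    ultimately show ?thesis unfolding r by blast
  qed
  \<comment> \<open>The doubled radius is at most \<open>8 * \<Lambda>\<close> times the distance to
    the anchor.\<close>
  obtain H where H: "0 < H" "\<And>x a b. dist x a \<le> (8 * \<Lambda>) * dist x b \<Longrightarrow> dist (f x) (f a) \<le> H * dist (f x) (f b)"
    using wqs unfolding weakly_quasisymmetric_def by meson
  have up: "measure pullback (ball x t) \<le> C * (2 * H) powr n * dist (f x) (f b) powr n"
    if "x \<noteq> b" "t \<le> 8 * \<Lambda> * dist x b" for x b t
    by (rule pullback_upper[OF H(2) that H(1)])
  define D where "D = max 1 (C * (2 * H) powr n * C1)"
  have doubling: "measure pullback (ball x (?rad (k - 1))) \<le> D * measure pullback (ball x (?rad k))"
    if gk: "good k" for k x
  proof -
    obtain y where y: "x \<noteq> y" "dist x y \<le> ?rad k" "?rad k \<le> 4 * \<Lambda> * dist x y"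
      using anchor[OF gk] by blast
    have "?rad (k - 1) = 2 powr (1 + - real_of_int k)" by (rule arg_cong) simp
    also have "\<dots> = 2 * ?rad k" by (subst powr_add) simp
    finally have "?rad (k - 1) \<le> 8 * \<Lambda> * dist x y" using y(3) by simp
    then have "measure pullback (ball x (?rad (k - 1))) \<le> C * (2 * H) powr n * dist (f x) (f y) powr n"
      by (rule up[OF y(1)])
    also have "\<dots> \<le> C * (2 * H) powr n * (C1 * measure pullback (ball x (?rad k)))"
      using C by (intro mult_left_mono C1(2) y) auto
    also have "\<dots> = (C * (2 * H) powr n * C1) * measure pullback (ball x (?rad k))" by (simp only: mult.assoc)
    also have "\<dots> \<le> D * measure pullback (ball x (?rad k))" unfolding D_def by (intro mult_right_mono) auto
    finally show ?thesis .
  qed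
  \<comment> \<open>Solves \<open>C * (2 * \<epsilon>) powr n * C1 = 1 / 2\<close>, so that image
    distances shrunk by \<epsilon> halve the mass.\<close>
  define \<epsilon> where "\<epsilon> = (1 / (2 * C * C1)) powr (1 / n) / 2"
  have \<epsilon>0: "0 < \<epsilon>" unfolding \<epsilon>_def using C C1(1) by simp
  have \<epsilon>: "C * (2 * \<epsilon>) powr n * C1 = 1 / 2"
    unfolding \<epsilon>_def using C C1(1) n by (simp add: powr_powr)
  obtain \<delta> where \<delta>: "0 < \<delta>" "\<And>x a b. dist x a \<le> \<delta> * dist x b \<Longrightarrow> dist (f x) (f a) \<le> \<epsilon> * dist (f x) (f b)"
    using wqs \<epsilon>0 unfolding weakly_quasisymmetric_def by meson
  \<comment> \<open>After this many halvings the radius is below \<delta> times the distance to the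
    anchor; the successor is taken only to have a positive number of steps.\<close>
  obtain m0 where m0: "(1 / 2) ^ m0 < \<delta> / (4 * \<Lambda>)"
    using real_arch_pow_inv[of "\<delta> / (4 * \<Lambda>)" "1 / 2"] \<delta>(1) perfect(1) by auto
  define m where "m = Suc m0"
  have "(1 / 2 :: real) ^ m \<le> (1 / 2) ^ m0" unfolding m_def by (intro power_decreasing) auto
  then have m: "0 < m" "(1 / 2) ^ m \<le> \<delta> / (4 * \<Lambda>)"
    using m0 by (simp add: m_def, linarith)
  have rad_add: "?rad (k + int j) = ?rad k * (1 / 2) ^ j" for k j
  proof -
    have "?rad (k + int j) = 2 powr (- real_of_int k + - real j)" by (rule arg_cong) simp
    also have "\<dots> = ?rad k * 2 powr (- real j)" by (rule powr_add)
    also have "2 powr (- real j) = (1 / 2 :: real) ^ j"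
      by (simp add: powr_minus powr_realpow power_one_over inverse_eq_divide)
    finally show ?thesis .
  qed
  have half: "measure pullback (ball x (?rad (k + int m))) \<le> measure pullback (ball x (?rad k)) / 2"
    if gk: "good k" for k x
  proof -
    obtain y where y: "x \<noteq> y" "dist x y \<le> ?rad k" "?rad k \<le> 4 * \<Lambda> * dist x y"
      using anchor[OF gk] by blast
    have "?rad (k + int m) \<le> (4 * \<Lambda> * dist x y) * (\<delta> / (4 * \<Lambda>))"
      unfolding rad_add using y(3) m(2) perfect(1) by (intro mult_mono) auto
    also have "\<dots> = \<delta> * dist x y" using perfect(1) by simp
    finally have le: "?rad (k + int m) \<le> \<delta> * dist x y" .
    have "measure pullback (ball x (?rad (k + int m))) \<le> C * (2 * \<epsilon>) powr n * dist (f x) (f y) powr n"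
      by (rule pullback_upper[OF \<delta>(2) y(1) le \<epsilon>0])
    also have "\<dots> \<le> C * (2 * \<epsilon>) powr n * (C1 * measure pullback (ball x (?rad k)))"
      using C by (intro mult_left_mono C1(2) y) auto
    also have "\<dots> = (C * (2 * \<epsilon>) powr n * C1) * measure pullback (ball x (?rad k))" by (simp only: mult.assoc)
    finally show ?thesis unfolding \<epsilon> by simp
  qed
  define q where "q = (1 / 2 :: real) powr (1 / real m)"
  have decay: "measure pullback (ball x (?rad (k + int j))) \<le> 2 * q ^ j * measure pullback (ball x (?rad k))"
    if gk: "good k" for k x j
  proof -
    define b where "b i = measure pullback (ball x (?rad (k + int i)))" for i
    have gki: "good (k + int i)" for i
    proof -
      obtain a' b' :: 'a where "2 powr (- real_of_int k - 2) \<le> dist a' b'" using gk unfolding good_def by blast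
      moreover have "2 powr (- real_of_int (k + int i) - 2) \<le> (2 powr (- real_of_int k - 2) :: real)"
        by (intro powr_mono) auto
      ultimately show ?thesis unfolding good_def by (meson order.trans)
    qed
    have "b j \<le> 2 * q ^ j * b 0" unfolding q_def
    proof (rule halving_imp_geometric[OF _ _ m(1)])
      show "b (Suc i) \<le> b i" for i
        unfolding b_def using pullback_finite
        by (intro measure_mono_fmeasurable subset_ball powr_mono) (auto simp: fmeasurable_def sets_pullback)
      show "b (i + m) \<le> b i / 2" for i unfolding b_def using half[OF gki[of i], of x] by (simp add: add.assoc)
      show "0 \<le> b i" for i unfolding b_def by simp
    qed
    then show ?thesis unfolding b_def by simp
  qed
  show ?thesis
  proof (rule that[of D q])
    show "1 \<le> D" unfolding D_def by simp
    show "0 < q" unfolding q_def by simp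
    show "q < 1" unfolding q_def using m(1) powr_less_mono2[of "1 / real m" "1 / 2" 1] by simp
  qed (use doubling decay in \<open>unfold good_def, blast+\<close>)
qed

end

section \<open>Transfer of function spaces\<close>

lemma finite_and_root_le:
  assumes "A \<le> ennreal c * B" "B < \<infinity>" "0 \<le> c" "0 < (p::real)"
  shows "A < \<infinity>" "enn2real A powr (1 / p) \<le> c powr (1 / p) * enn2real B powr (1 / p)"
proof -
  have fin: "ennreal c * B < \<infinity>" using assms(2) by (simp add: ennreal_mult_less_top)
  show "A < \<infinity>" by (rule le_less_trans[OF assms(1) fin])
  have "enn2real A \<le> enn2real (ennreal c * B)" using assms(1) fin by (intro enn2real_mono) auto
  also have "\<dots> = c * enn2real B" using assms(3) by (simp add: enn2real_mult)
  finally have "enn2real A powr (1 / p) \<le> (c * enn2real B) powr (1 / p)"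
    using assms(4) by (intro powr_mono2) auto
  then show "enn2real A powr (1 / p) \<le> c powr (1 / p) * enn2real B powr (1 / p)"
    using assms(3) by (simp add: powr_mult)
qed

text \<open>The Besov energy is the right middle term: changing variables by \<open>g\<close> turns
  it into an integral over pairs for the pulled-back measure, and \<open>s2 * p = n2\<close> makes
  its kernel comparable to that of \<open>P.energy\<close>.\<close>

lemma hajlasz_of_pullback_le:
  fixes M :: "'a::metric_space measure" and N :: "'b::metric_space measure"
  assumes mmM: "metric_measure_space M" and mmN: "metric_measure_space N"
    and n: "0 < n1" "0 < n2" and reg: "ahlfors_regular M n1" "ahlfors_regular N n2"
    and hom: "homeomorphism UNIV UNIV f g" and wqs: "weakly_quasisymmetric f"
    and ne: "a0 \<noteq> (b0::'a)" and p: "1 \<le> p" and s: "s1 * p = n1" "s2 * p = n2"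
  shows "\<exists>K>0. \<forall>u\<in>borel_measurable N. besov_pow N s2 p u < \<infinity> \<longrightarrow>
    (\<exists>u'. (AE y in N. u' y = u y) \<and> u' \<circ> f \<in> borel_measurable M \<and>
      hajlasz_besov_pow M s1 p (u' \<circ> f) \<le> ennreal K * besov_pow N s2 p u)"
proof -
  note sets_M = metric_measure_spaceD(1)[OF mmM] and sets_N = metric_measure_spaceD(1)[OF mmN]
  have "f a0 \<noteq> f b0" using ne hom unfolding homeomorphism_def by (metis UNIV_I)
  then obtain CN where CN: "1 \<le> CN"
    "\<And>x r. 0 < r \<Longrightarrow> measure N (ball x r) \<le> CN * r powr n2"
    "\<And>x r a b. 0 < r \<Longrightarrow> r \<le> dist a (b::'b) \<Longrightarrow> r powr n2 / CN \<le> measure N (ball x r)"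
    using ahlfors_measure_bounds[OF mmN reg(2) n(2)] by metis
  obtain CM where CM: "1 \<le> CM" "\<And>x r. 0 < r \<Longrightarrow> emeasure M (ball x r) \<le> ennreal (CM * r powr n1)"
    using ahlfors_measure_bounds[OF mmM reg(1) n(1) ne] by metis
  obtain \<Lambda> where perfect: "1 \<le> \<Lambda>"
    "\<forall>(x::'a) r a b. 0 < r \<longrightarrow> r \<le> dist a (b::'a) \<longrightarrow> (\<exists>y. r / \<Lambda> \<le> dist x y \<and> dist x y < r)"
    using ahlfors_uniformly_perfect[OF sets_M reg(1) n(1) ne] by metis
  obtain Z :: "'a set" where Z: "countable Z" "closure Z = UNIV"
    using ahlfors_separable[OF sets_M reg(1) n(1) ne] by blast
  interpret Q: quasisymmetric_pullback N f g n2 CN a0 b0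
    by unfold_locales (use mmN wqs hom n ne CN in auto)
  obtain D q where Dq: "1 \<le> D" "0 < q" "q < 1"
    "\<And>k x. \<exists>a b::'a. 2 powr (- real_of_int k - 2) \<le> dist a b \<Longrightarrow>
      measure Q.pullback (ball x (2 powr (- real_of_int (k - 1)))) \<le> D * measure Q.pullback (ball x (2 powr (- real_of_int k)))"
    "\<And>k x j. \<exists>a b::'a. 2 powr (- real_of_int k - 2) \<le> dist a b \<Longrightarrow>
      measure Q.pullback (ball x (2 powr (- real_of_int (k + int j)))) \<le> 2 * q ^ j * measure Q.pullback (ball x (2 powr (- real_of_int k)))"
    by (rule Q.pullback_doubling_decay[OF perfect]) (rule that; assumption)
  interpret P: doubling_pair Q.pullback M D 2 q CM n1 p
  proof
    show "(\<lambda>z. dist (fst z) (snd z) :: real) \<in> borel_measurable (borel \<Otimes>\<^sub>M (borel :: 'a measure))"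
      by (rule borel_measurable_dist_separable[OF Z])
  qed (use Q.sets_pullback sets_M Q.pullback_finite Q.pullback_pos Dq CM n p in blast | use CM n Dq p in simp)+
  obtain C1 where C1: "0 < C1"
    "\<And>x b t. x \<noteq> b \<Longrightarrow> dist x b \<le> t \<Longrightarrow> dist (f x) (f b) powr n2 \<le> C1 * measure Q.pullback (ball x t)"
    using Q.pullback_lower by blast
  \<comment> \<open>\<open>CN\<close> bounds \<open>Vball\<close> by a power of the distance; each
    of the two resulting powers costs one \<open>C1\<close> when traded for pulled-back
    mass.\<close>
  define c where "c = C1\<^sup>2 * CN"
  have c: "0 < c" unfolding c_def using C1 CN by simp
  have energy: "P.energy (u \<circ> f) \<le> ennreal c * besov_pow N s2 p u" if "u \<in> borel_measurable borel" for u
  proof -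
    define v where "v = u \<circ> f"
    have [measurable]: "v \<in> borel_measurable borel"
      unfolding v_def by (rule measurable_comp[OF Q.f_measurable that])
    define h where "h x z = ennreal (1 / c) * ennreal (\<bar>v x - v z\<bar> powr p / (measure Q.pullback (ball x (dist x z)))\<^sup>2)" for x z
    have h1: "h x \<in> borel_measurable borel" for x unfolding h_def[abs_def] by measurable
    have h2: "(\<lambda>x. \<integral>\<^sup>+ z. h x z \<partial>Q.pullback) \<in> borel_measurable borel"
      unfolding h_def[abs_def] by measurable
    have "ennreal (1 / c) * P.energy v = (\<integral>\<^sup>+ x. (\<integral>\<^sup>+ z. h x z \<partial>Q.pullback) \<partial>Q.pullback)"
      unfolding P.energy_def h_def by (simp add: nn_integral_cmult)
    also have "\<dots> = (\<integral>\<^sup>+ y. (\<integral>\<^sup>+ z. h (g y) z \<partial>Q.pullback) \<partial>N)"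
      using h2 by (subst (1) Q.pullback_def) (subst nn_integral_distr[OF Q.g_measurable], simp_all)
    also have "\<dots> = (\<integral>\<^sup>+ y. (\<integral>\<^sup>+ w. h (g y) (g w) \<partial>N) \<partial>N)"
      using h1 unfolding Q.pullback_def
      by (intro nn_integral_cong nn_integral_distr[OF Q.g_measurable]) simp
    also have "\<dots> \<le> besov_pow N s2 p u"
      unfolding besov_pow_def
    proof (intro nn_integral_mono)
      fix y w
      show "h (g y) (g w) \<le> ennreal (\<bar>u y - u w\<bar> powr p / (dist y w powr (s2 * p) * Vball N y w))"
      proof (cases "y = w")
        case False
        let ?d = "dist y w" and ?F = "\<bar>u y - u w\<bar> powr p"
        let ?s = "measure Q.pullback (ball (g y) (dist (g y) (g w)))" and ?V = "Vball N y w"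
        have d: "0 < ?d" using False by simp
        have gne: "g y \<noteq> g w" using False Q.fg by metis
        have s0: "0 < ?s" using gne by (intro Q.pullback_pos) simp
        have V0: "0 < ?V" unfolding Vball_def by (rule metric_measure_spaceD(4)[OF mmN d])
        have V: "?V \<le> CN * ?d powr n2" unfolding Vball_def by (rule CN(2)[OF d])
        have dn: "?d powr n2 \<le> C1 * ?s" using C1(2)[OF gne order.refl] by simp
        have "?d powr n2 * ?V \<le> ?d powr n2 * (CN * ?d powr n2)" using V by (intro mult_left_mono) auto
        also have "\<dots> = CN * (?d powr n2)\<^sup>2" by (simp add: power2_eq_square)
        also have "\<dots> \<le> CN * (C1 * ?s)\<^sup>2" using dn CN(1) by (intro mult_left_mono power_mono) auto
        also have "\<dots> = c * ?s\<^sup>2" unfolding c_def by (simp add: power_mult_distrib)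
        finally have "?F * (?d powr n2 * ?V) \<le> ?F * (c * ?s\<^sup>2)" by (intro mult_left_mono) auto
        then have "1 / c * (?F / ?s\<^sup>2) \<le> ?F / (?d powr (s2 * p) * ?V)"
          unfolding s(2) using s0 V0 d c by (simp add: field_simps)
        then show ?thesis unfolding h_def v_def using c
          by (subst ennreal_mult'[symmetric]) (auto intro: ennreal_leI)
      qed (simp add: h_def v_def)
    qed
    finally have "ennreal c * (ennreal (1 / c) * P.energy v) \<le> ennreal c * besov_pow N s2 p u"
      by (rule mult_left_mono) simp
    moreover have "ennreal c * ennreal (1 / c) = 1" using c by (simp add: ennreal_mult[symmetric])
    ultimately show ?thesis unfolding v_def[symmetric] by (simp add: mult.assoc[symmetric])
  qed
  \<comment> \<open>The absolute value and the added 1 give a positive constant without examining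
    the sign of \<open>P.hajlasz_const\<close>.\<close>
  define K where "K = \<bar>P.hajlasz_const\<bar> * c + 1"
  have K: "0 < K" unfolding K_def using c by (simp add: add_nonneg_pos)
  have "(\<exists>u'. (AE y in N. u' y = u y) \<and> u' \<circ> f \<in> borel_measurable M \<and>
      hajlasz_besov_pow M s1 p (u' \<circ> f) \<le> ennreal K * besov_pow N s2 p u)"
    if u: "u \<in> borel_measurable N" and fin: "besov_pow N s2 p u < \<infinity>" for u
  proof -
    have ub: "u \<in> borel_measurable borel" using u measurable_cong_sets[OF sets_N refl] by blast
    define v where "v = u \<circ> f"
    have v: "v \<in> borel_measurable borel" unfolding v_def by (rule measurable_comp[OF Q.f_measurable ub])
    have efin: "P.energy v < \<infinity>"
      using fin unfolding v_def by (intro le_less_trans[OF energy[OF ub]]) (simp add: ennreal_mult_less_top)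
    \<comment> \<open>The composition \<open>u' \<circ> f\<close> equals \<open>P.repr v\<close> at
      every point, while equality with \<open>u\<close> almost everywhere for \<open>N\<close> is
      the pulled-back almost-everywhere statement read through \<open>distr\<close>.\<close>
    define u' where "u' = P.repr v \<circ> g"
    have comp: "u' \<circ> f = P.repr v" unfolding u'_def by (simp add: fun_eq_iff)
    obtain k :: int where k: "2 powr (- real_of_int k - 1) \<le> dist a0 b0"
      using dyadic_scale_exists[of "dist a0 b0"] ne by auto
    have "2 powr (- real_of_int k - 2) \<le> (2 powr (- real_of_int k - 1) :: real)" by simp
    then have "P.good k" unfolding P.good_def using k by (meson order.trans)
    from P.repr_AE_eq[OF v efin this] have "AE x in distr N borel g. P.repr v x = v x"
      unfolding Q.pullback_def .
    from AE_distrD[OF Q.g_measurable this] have "AE y in N. u' y = u y"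
      unfolding u'_def v_def by simp
    moreover have "u' \<circ> f \<in> borel_measurable M"
      unfolding comp using P.repr_measurable[OF v] measurable_cong_sets[OF sets_M refl] by blast
    moreover have "hajlasz_besov_pow M s1 p (u' \<circ> f) \<le> ennreal K * besov_pow N s2 p u"
    proof -
      have "n1 / p = s1" using s(1) p by auto
      then have "hajlasz_besov_pow M s1 p (u' \<circ> f) \<le> ennreal P.hajlasz_const * P.energy v"
        unfolding comp using P.hajlasz_repr_le[OF v efin] by simp
      also have "\<dots> \<le> ennreal \<bar>P.hajlasz_const\<bar> * (ennreal c * besov_pow N s2 p u)"
        unfolding v_def by (intro mult_mono energy[OF ub] ennreal_leI) auto
      also have "\<dots> = ennreal (\<bar>P.hajlasz_const\<bar> * c) * besov_pow N s2 p u"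
        using c by (simp add: ennreal_mult mult.assoc)
      also have "\<dots> \<le> ennreal K * besov_pow N s2 p u"
        unfolding K_def by (intro mult_right_mono ennreal_leI) auto
      finally show ?thesis .
    qed
    ultimately show ?thesis by blast
  qed
  then show ?thesis using K by blast
qed

text \<open>Every route crosses from the Besov energy on \<open>N\<close> to the Hajlasz energy on
  \<open>M\<close>. Hajlasz spaces prepend \<open>besov_le_hajlasz\<close> on \<open>N\<close>,
  Besov spaces append it on \<open>M\<close>; this explains the two constants \<open>K * BN\<close>
  and \<open>BM * K\<close>.\<close>

lemma transfer_spaces:
  fixes M :: "'a::metric_space measure" and N :: "'b::metric_space measure"
  assumes mmM: "metric_measure_space M" and mmN: "metric_measure_space N"
    and n: "0 < n1" "0 < n2" and reg: "ahlfors_regular M n1" "ahlfors_regular N n2"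
    and hom: "homeomorphism UNIV UNIV f g" and wqs: "weakly_quasisymmetric f"
    and ne: "a0 \<noteq> (b0::'a)" and p: "1 \<le> p" and s: "s1 * p = n1" "s2 * p = n2" and s1: "0 \<le> s1"
  shows "\<exists>C>0.
    (\<forall>u. in_hajlasz_besov N s2 p u \<longrightarrow>
       (\<exists>u'. (AE y in N. u' y = u y) \<and> in_hajlasz_besov M s1 p (u' \<circ> f) \<and>
          hajlasz_besov_norm M s1 p (u' \<circ> f) \<le> C * hajlasz_besov_norm N s2 p u)) \<and>
    (\<forall>u. in_besov N s2 p u \<longrightarrow>
       (\<exists>u'. (AE y in N. u' y = u y) \<and> in_besov M s1 p (u' \<circ> f) \<and>
          besov_norm M s1 p (u' \<circ> f) \<le> C * besov_norm N s2 p u))"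
proof -
  obtain K where K: "0 < K" "\<And>u. u \<in> borel_measurable N \<Longrightarrow> besov_pow N s2 p u < \<infinity> \<Longrightarrow>
    (\<exists>u'. (AE y in N. u' y = u y) \<and> u' \<circ> f \<in> borel_measurable M \<and>
      hajlasz_besov_pow M s1 p (u' \<circ> f) \<le> ennreal K * besov_pow N s2 p u)"
    using hajlasz_of_pullback_le[OF mmM mmN n reg hom wqs ne p s] by blast
  have "f a0 \<noteq> f b0" using ne hom unfolding homeomorphism_def by (metis UNIV_I)
  from besov_le_hajlasz[OF mmN reg(2) n(2) this p, of s2]
  obtain BN where BN: "0 < BN" "\<And>u. besov_pow N s2 p u \<le> ennreal BN * hajlasz_besov_pow N s2 p u" by blast
  from besov_le_hajlasz[OF mmM reg(1) n(1) ne p, of s1]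
  obtain BM where BM: "0 < BM" "\<And>u. besov_pow M s1 p u \<le> ennreal BM * hajlasz_besov_pow M s1 p u" by blast
  have p0: "0 < p" using p by simp
  define C where "C = max ((K * BN) powr (1 / p)) ((BM * K) powr (1 / p))"
  have C: "0 < C" "(K * BN) powr (1 / p) \<le> C" "(BM * K) powr (1 / p) \<le> C"
    unfolding C_def using K BN by (auto simp: less_max_iff_disj)
  have mult: "ennreal a * (ennreal b * X) = ennreal (a * b) * X" if "0 < a" "0 < b" for a b X
    using that by (simp add: ennreal_mult mult.assoc)
  have hajlasz: "\<exists>u'. (AE y in N. u' y = u y) \<and> in_hajlasz_besov M s1 p (u' \<circ> f) \<and>
      hajlasz_besov_norm M s1 p (u' \<circ> f) \<le> C * hajlasz_besov_norm N s2 p u"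
    if u: "in_hajlasz_besov N s2 p u" for u
  proof -
    have um: "u \<in> borel_measurable N" and hfin: "hajlasz_besov_pow N s2 p u < \<infinity>"
      using u unfolding in_hajlasz_besov_def by auto
    obtain u' where u': "AE y in N. u' y = u y" "u' \<circ> f \<in> borel_measurable M"
      "hajlasz_besov_pow M s1 p (u' \<circ> f) \<le> ennreal K * besov_pow N s2 p u"
      using K(2)[OF um finite_and_root_le(1)[OF BN(2) hfin _ p0]] BN(1) by auto
    have "hajlasz_besov_pow M s1 p (u' \<circ> f) \<le> ennreal K * (ennreal BN * hajlasz_besov_pow N s2 p u)"
      by (rule order.trans[OF u'(3)]) (intro mult_left_mono BN(2), simp)
    then have le: "hajlasz_besov_pow M s1 p (u' \<circ> f) \<le> ennreal (K * BN) * hajlasz_besov_pow N s2 p u"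
      unfolding mult[OF K(1) BN(1)] .
    have "hajlasz_besov_norm M s1 p (u' \<circ> f) \<le> (K * BN) powr (1 / p) * hajlasz_besov_norm N s2 p u"
      unfolding hajlasz_besov_norm_def using K(1) BN(1) by (intro finite_and_root_le(2)[OF le hfin _ p0]) simp
    also have "\<dots> \<le> C * hajlasz_besov_norm N s2 p u"
      using C(2) by (intro mult_right_mono) (auto simp: hajlasz_besov_norm_def)
    finally have norm: "hajlasz_besov_norm M s1 p (u' \<circ> f) \<le> C * hajlasz_besov_norm N s2 p u" .
    have "in_hajlasz_besov M s1 p (u' \<circ> f)"
      unfolding in_hajlasz_besov_def using u'(2) finite_and_root_le(1)[OF le hfin _ p0] K(1) BN(1) by simp
    then show ?thesis using u'(1) norm by blast
  qed
  have besov: "\<exists>u'. (AE y in N. u' y = u y) \<and> in_besov M s1 p (u' \<circ> f) \<and>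
      besov_norm M s1 p (u' \<circ> f) \<le> C * besov_norm N s2 p u"
    if u: "in_besov N s2 p u" for u
  proof -
    have um: "u \<in> borel_measurable N" and bfin: "besov_pow N s2 p u < \<infinity>"
      using u unfolding in_besov_def Lp_loc_def by auto
    obtain u' where u': "AE y in N. u' y = u y" "u' \<circ> f \<in> borel_measurable M"
      "hajlasz_besov_pow M s1 p (u' \<circ> f) \<le> ennreal K * besov_pow N s2 p u"
      using K(2)[OF um bfin] by auto
    have "besov_pow M s1 p (u' \<circ> f) \<le> ennreal BM * (ennreal K * besov_pow N s2 p u)"
      by (rule order.trans[OF BM(2)]) (intro mult_left_mono u'(3), simp)
    then have le: "besov_pow M s1 p (u' \<circ> f) \<le> ennreal (BM * K) * besov_pow N s2 p u"
      unfolding mult[OF BM(1) K(1)] .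
    have "besov_norm M s1 p (u' \<circ> f) \<le> (BM * K) powr (1 / p) * besov_norm N s2 p u"
      unfolding besov_norm_def using K(1) BM(1) by (intro finite_and_root_le(2)[OF le bfin _ p0]) simp
    also have "\<dots> \<le> C * besov_norm N s2 p u"
      using C(3) by (intro mult_right_mono) (auto simp: besov_norm_def)
    finally have norm: "besov_norm M s1 p (u' \<circ> f) \<le> C * besov_norm N s2 p u" .
    have fin: "besov_pow M s1 p (u' \<circ> f) < \<infinity>"
      using finite_and_root_le(1)[OF le bfin _ p0] K(1) BM(1) by simp
    then have "in_besov M s1 p (u' \<circ> f)"
      unfolding in_besov_def using Lp_loc_of_besov_finite[OF mmM u'(2) fin s1 p] by simp
    then show ?thesis using u'(1) norm by blast
  qed
  show ?thesis using C(1) hajlasz besov by blast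
qed

text \<open>With diameter 0 no radius is admissible and regularity carries no information, so this
  case stands apart; here the zero sequence is a gradient of every function.\<close>

lemma one_point_space:
  fixes M :: "'a::metric_space measure"
  assumes mm: "metric_measure_space M" and one: "\<And>x y :: 'a. x = y"
  shows "in_hajlasz_besov M s p u" "hajlasz_besov_norm M s p u = 0"
    "in_besov M s p u" "besov_norm M s p u = 0"
proof -
  note sets_M = metric_measure_spaceD(1)[OF mm]
  have meas: "u \<in> borel_measurable M" for u :: "'a \<Rightarrow> real"
  proof -
    have "u = (\<lambda>x. u undefined)" using one by metis
    then show ?thesis by (metis measurable_const UNIV_I space_borel)
  qed
  have "(\<lambda>k x. 0) \<in> frac_hajlasz_grad M s u"
    unfolding frac_hajlasz_grad_def by (auto intro!: bexI[of _ "{}"] arg_cong[of _ _ u] one)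
  then have "hajlasz_besov_pow M s p u \<le>
      (\<integral>\<^sup>+ x. (\<integral>\<^sup>+ k. ennreal ((\<lambda>(k::int) (x::'a). 0::real) k x powr p) \<partial>count_space UNIV) \<partial>M)"
    unfolding hajlasz_besov_pow_def by (rule INF_lower)
  then have h0: "hajlasz_besov_pow M s p u = 0" by simp
  show "in_hajlasz_besov M s p u" "hajlasz_besov_norm M s p u = 0"
    unfolding in_hajlasz_besov_def hajlasz_besov_norm_def using meas h0 by auto
  have zero: "ennreal (\<bar>u x - u y\<bar> powr p / (dist x y powr (s * p) * Vball M x y)) = 0" for x y
    by (simp add: one[of x y])
  have b0: "besov_pow M s p u = 0" unfolding besov_pow_def zero by simp
  have "(\<integral>\<^sup>+ y. indicator (ball x r) y * ennreal (\<bar>u y\<bar> powr p) \<partial>M) < \<infinity>" for x r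
  proof -
    have "(\<integral>\<^sup>+ y. indicator (ball x r) y * ennreal (\<bar>u y\<bar> powr p) \<partial>M) =
        (\<integral>\<^sup>+ y. ennreal (\<bar>u x\<bar> powr p) * indicator (ball x r) y \<partial>M)"
      using one by (intro nn_integral_cong) (metis mult.commute)
    also have "\<dots> = ennreal (\<bar>u x\<bar> powr p) * emeasure M (ball x r)"
      by (rule nn_integral_cmult_indicator) (simp add: sets_M)
    also have "\<dots> < \<infinity>" using metric_measure_spaceD(3)[OF mm] by (simp add: ennreal_mult_less_top)
    finally show ?thesis .
  qed
  then show "in_besov M s p u" "besov_norm M s p u = 0"
    unfolding in_besov_def Lp_loc_def besov_norm_def using meas b0 by auto
qed

theorem theorem5p1:
  fixes M :: "'a::metric_space measure" and N :: "'b::metric_space measure"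
    and f :: "'a \<Rightarrow> 'b" and n1 n2 s1 s2 :: real
  assumes "metric_measure_space M" and "metric_measure_space N"
    and "0 < n1" and "0 < n2"
    and "ahlfors_regular M n1" and "ahlfors_regular N n2"
    and "quasisymmetric f"
    and "0 < s1" and "s1 < n1" and "0 < s2" and "s2 < n2"
    and "n1 / s1 = n2 / s2"
  shows "\<exists>C>0.
    (\<forall>u. in_hajlasz_besov N s2 (n2/s2) u \<longrightarrow>
       (\<exists>u'. (AE y in N. u' y = u y) \<and> in_hajlasz_besov M s1 (n1/s1) (u' \<circ> f) \<and>
          hajlasz_besov_norm M s1 (n1/s1) (u' \<circ> f) \<le> C * hajlasz_besov_norm N s2 (n2/s2) u)) \<and>
    (\<forall>v. in_hajlasz_besov M s1 (n1/s1) v \<longrightarrow>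
       (\<exists>v'. (AE x in M. v' x = v x) \<and> in_hajlasz_besov N s2 (n2/s2) (v' \<circ> inv f) \<and>
          hajlasz_besov_norm N s2 (n2/s2) (v' \<circ> inv f) \<le> C * hajlasz_besov_norm M s1 (n1/s1) v)) \<and>
    (\<forall>u. in_besov N s2 (n2/s2) u \<longrightarrow>
       (\<exists>u'. (AE y in N. u' y = u y) \<and> in_besov M s1 (n1/s1) (u' \<circ> f) \<and>
          besov_norm M s1 (n1/s1) (u' \<circ> f) \<le> C * besov_norm N s2 (n2/s2) u)) \<and>
    (\<forall>v. in_besov M s1 (n1/s1) v \<longrightarrow>
       (\<exists>v'. (AE x in M. v' x = v x) \<and> in_besov N s2 (n2/s2) (v' \<circ> inv f) \<and>
          besov_norm N s2 (n2/s2) (v' \<circ> inv f) \<le> C * besov_norm M s1 (n1/s1) v))"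
proof -
  define p where "p = n1 / s1"
  have p: "p = n1 / s1" "p = n2 / s2" using assms(12) unfolding p_def by auto
  have s: "s1 * p = n1" "s2 * p = n2" using assms(8,10) p by (auto simp: field_simps)
  have p1: "1 \<le> p" unfolding p_def using assms(8,9) by simp
  obtain g where hom: "homeomorphism UNIV UNIV f g" using assms(7) unfolding quasisymmetric_def by blast
  have fg: "f (g y) = y" and gf: "g (f x) = x" for x y using hom unfolding homeomorphism_def by auto
  have inv: "inv f = g" using fg gf by (intro inv_unique_comp) (auto simp: fun_eq_iff)
  have wf: "weakly_quasisymmetric f" by (rule quasisymmetric_imp_weakly[OF assms(7)])
  have wg: "weakly_quasisymmetric g" by (rule weakly_quasisymmetric_inverse[OF wf fg gf])
  show ?thesis
  \<comment> \<open>All quantitative bounds above start from a pair of distinct points.\<close>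
  proof (cases "\<forall>x y :: 'a. x = y")
    case True
    then have one: "x = y" for x y :: 'a by blast
    then have one': "x = y" for x y :: 'b using fg by metis
    note M = one_point_space[OF assms(1) one] and N = one_point_space[OF assms(2) one']
    show ?thesis
      by (intro exI[of _ 1] conjI allI impI exI) (auto simp: M N)
  next
    case False
    then obtain a0 b0 :: 'a where ne: "a0 \<noteq> b0" by blast
    then have ne': "f a0 \<noteq> f b0" using gf by metis
    obtain C1 where C1: "0 < C1"
      "\<And>u. in_hajlasz_besov N s2 p u \<Longrightarrow> \<exists>u'. (AE y in N. u' y = u y) \<and> in_hajlasz_besov M s1 p (u' \<circ> f) \<and>
          hajlasz_besov_norm M s1 p (u' \<circ> f) \<le> C1 * hajlasz_besov_norm N s2 p u"
      "\<And>u. in_besov N s2 p u \<Longrightarrow> \<exists>u'. (AE y in N. u' y = u y) \<and> in_besov M s1 p (u' \<circ> f) \<and>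
          besov_norm M s1 p (u' \<circ> f) \<le> C1 * besov_norm N s2 p u"
      using transfer_spaces[OF assms(1-6) hom wf ne p1 s less_imp_le[OF assms(8)]] by blast
    obtain C2 where C2: "0 < C2"
      "\<And>v. in_hajlasz_besov M s1 p v \<Longrightarrow> \<exists>v'. (AE x in M. v' x = v x) \<and> in_hajlasz_besov N s2 p (v' \<circ> g) \<and>
          hajlasz_besov_norm N s2 p (v' \<circ> g) \<le> C2 * hajlasz_besov_norm M s1 p v"
      "\<And>v. in_besov M s1 p v \<Longrightarrow> \<exists>v'. (AE x in M. v' x = v x) \<and> in_besov N s2 p (v' \<circ> g) \<and>
          besov_norm N s2 p (v' \<circ> g) \<le> C2 * besov_norm M s1 p v"
      using transfer_spaces[OF assms(2,1,4,3,6,5) homeomorphism_symD[OF hom] wg ne' p1 s(2,1) less_imp_le[OF assms(10)]]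
      by blast
    let ?C = "max C1 C2"
    have mono: "C1 * hajlasz_besov_norm N s2 p u \<le> ?C * hajlasz_besov_norm N s2 p u"
      "C2 * hajlasz_besov_norm M s1 p v \<le> ?C * hajlasz_besov_norm M s1 p v"
      "C1 * besov_norm N s2 p u \<le> ?C * besov_norm N s2 p u"
      "C2 * besov_norm M s1 p v \<le> ?C * besov_norm M s1 p v" for u v
      unfolding hajlasz_besov_norm_def besov_norm_def by (auto intro!: mult_right_mono)
    show ?thesis unfolding p(1)[symmetric] p(2)[symmetric] inv
    proof (intro exI[of _ ?C] conjI allI impI)
      show "0 < ?C" using C1(1) by simp
      show "\<exists>u'. (AE y in N. u' y = u y) \<and> in_hajlasz_besov M s1 p (u' \<circ> f) \<and>
          hajlasz_besov_norm M s1 p (u' \<circ> f) \<le> ?C * hajlasz_besov_norm N s2 p u"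
        if "in_hajlasz_besov N s2 p u" for u
        using C1(2)[OF that] mono(1)[of u] by (blast intro: order.trans)
      show "\<exists>v'. (AE x in M. v' x = v x) \<and> in_hajlasz_besov N s2 p (v' \<circ> g) \<and>
          hajlasz_besov_norm N s2 p (v' \<circ> g) \<le> ?C * hajlasz_besov_norm M s1 p v"
        if "in_hajlasz_besov M s1 p v" for v
        using C2(2)[OF that] mono(2)[of v] by (blast intro: order.trans)
      show "\<exists>u'. (AE y in N. u' y = u y) \<and> in_besov M s1 p (u' \<circ> f) \<and>
          besov_norm M s1 p (u' \<circ> f) \<le> ?C * besov_norm N s2 p u"
        if "in_besov N s2 p u" for u
        using C1(3)[OF that] mono(3)[of u] by (blast intro: order.trans)
      show "\<exists>v'. (AE x in M. v' x = v x) \<and> in_besov N s2 p (v' \<circ> g) \<and>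
          besov_norm N s2 p (v' \<circ> g) \<le> ?C * besov_norm M s1 p v"
        if "in_besov M s1 p v" for v
        using C2(3)[OF that] mono(4)[of v] by (blast intro: order.trans)
    qed
  qed
qed

end
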